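(* Let $\nabla$ be a connection on $M$ (i.e. a connection on the tangent bundle $TM$). Then $\nabla^n f$ (that is, the map $f\mapsto\nabla^n f$, $f\in\mathcal F(M)$) is an $n$-th order Hessian structure on $M$, for all $n\ge 1$.
   Context: $M$ is a Hausdorff, paracompact, smooth finite-dimensional manifold; $\mathcal F(M)$ is the space of smooth real-valued functions on $M$; $\Omega^n(M)$ is the space of covariant tensors (smooth covariant tensor fields) of order $n$ on $M$, not necessarily symmetric. For $m\in M$, $F_m$ is the set of smooth real-valued functions defined on an open neighbourhood of $m$ and vanishing at $m$; $F_m^n$ is the space of all sums of products of $n$ elements of $F_m$; equivalently, $f\in F_m^n$ iff in some (hence any) chart at $m$ all partial derivatives of $f$ of order up to and including $n-1$ (order $0$ included) vanish at $m$. For $f\in F_m^n$ and $v_1,\dots,v_n\in T_mM$ one sets $D^nf(m)(v_1,\dots,v_n)=(X_1\cdot X_2\cdots X_n\cdot f)(m)$, where $X_i$ are any smooth vector fields with $X_i(m)=v_i$; this is well-defined and symmetric in the $v_i$, and in any chart it is given by the $n$-th Fréchet derivative. An $n$-th order Hessian structure on $M$ is a map $H^n:\mathcal F(M)\to\Omega^n(M)$, $f\mapsto H^nf$, such that (i) $H^n$ is real linear in $f$, and (ii) if $f\in F_m^n$ then $H^nf(m)=D^nf(m)$. A connection on $M$ is a Koszul connection $\nabla$ on $TM$. For $\omega\in\Omega^n(M)$, $\nabla\omega\in\Omega^{n+1}(M)$ is defined by $\nabla\omega(X_0,\dots,X_n)=X_0\cdot(\omega(X_1,\dots,X_n))-\sum_{i=1}^n\omega(X_1,\dots,\nabla_{X_0}X_i,\dots,X_n)$.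 For $f\in\mathcal F(M)$, $\nabla^1f=\nabla f=df$ and recursively $\nabla^{n+1}f=\nabla(\nabla^nf)$. *)

theory Defs
  imports "HOL-Analysis.Analysis"
begin

section \<open>Smooth maps between normed spaces\<close>

text \<open>
  The domain is going to be finite-dimensional, where the condition on all directional derivatives
  is the usual notion of a \<open>C\<^sup>k\<close> map on the open set \<open>S\<close>.
\<close>

primrec Ck_on :: "nat \<Rightarrow> 'e::real_normed_vector set \<Rightarrow> ('e \<Rightarrow> 'b::real_normed_vector) \<Rightarrow> bool" where
  "Ck_on 0 S f \<longleftrightarrow> continuous_on S f"
| "Ck_on (Suc k) S f \<longleftrightarrow>
     (\<forall>x\<in>S. f differentiable (at x)) \<and> (\<forall>v. Ck_on k S (\<lambda>x. frechet_derivative f (at x) v))"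

definition smooth_on :: "'e::real_normed_vector set \<Rightarrow> ('e \<Rightarrow> 'b::real_normed_vector) \<Rightarrow> bool" where
  "smooth_on S f \<longleftrightarrow> (\<forall>k. Ck_on k S f)"


section \<open>Smooth manifolds\<close>

definition paracompact_space :: "'a topology \<Rightarrow> bool" where
  "paracompact_space X \<longleftrightarrow>
     (\<forall>\<U>. (\<forall>U\<in>\<U>. openin X U) \<and> \<Union>\<U> = topspace X \<longrightarrow>
        (\<exists>\<V>. (\<forall>V\<in>\<V>. openin X V) \<and> \<Union>\<V> = topspace X \<and>
             (\<forall>V\<in>\<V>. \<exists>U\<in>\<U>. V \<subseteq> U) \<and> locally_finite_in X \<V>))"

text \<open>
  The manifold is the type \<open>'a\<close>. A chart is its domain together with the chart map. The model
  space \<open>'e\<close> is a finite-dimensional inner product space; the class \<open>euclidean_space\<close> is avoided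
  because it rules out dimension zero. The atlas need not be maximal.
\<close>

type_synonym ('a, 'e) chart = "'a set \<times> ('a \<Rightarrow> 'e)"

definition smooth_manifold :: "('a::t2_space, 'e::real_inner) chart set \<Rightarrow> bool" where
  "smooth_manifold A \<longleftrightarrow>
     (\<exists>B::'e set. finite B \<and> span B = UNIV) \<and>
     paracompact_space (euclidean :: 'a topology) \<and>
     (\<forall>(U, \<phi>)\<in>A. open U \<and> open (\<phi> ` U) \<and> homeomorphism U (\<phi> ` U) \<phi> (inv_into U \<phi>)) \<and>
     (\<Union>(U, \<phi>)\<in>A. U) = UNIV \<and>
     (\<forall>(U, \<phi>)\<in>A. \<forall>(V, \<psi>)\<in>A. smooth_on (\<phi> ` (U \<inter> V)) (\<psi> \<circ> inv_into U \<phi>))"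

text \<open>
  A real function defined and smooth on an open set \<open>U\<close> is represented by a total function whose
  values outside \<open>U\<close> are irrelevant.
\<close>

definition smooth_fun_on :: "('a::t2_space, 'e::real_inner) chart set \<Rightarrow> 'a set \<Rightarrow> ('a \<Rightarrow> real) \<Rightarrow> bool" where
  "smooth_fun_on A U f \<longleftrightarrow>
     open U \<and> (\<forall>(V, \<phi>)\<in>A. smooth_on (\<phi> ` (U \<inter> V)) (f \<circ> inv_into V \<phi>))"

definition smooth_functions :: "('a::t2_space, 'e::real_inner) chart set \<Rightarrow> ('a \<Rightarrow> real) set" where
  "smooth_functions A = {f. smooth_fun_on A UNIV f}"

definition smooth_near :: "('a::t2_space, 'e::real_inner) chart set \<Rightarrow> 'a \<Rightarrow> ('a \<Rightarrow> real) \<Rightarrow> bool" where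
  "smooth_near A m f \<longleftrightarrow> (\<exists>U. m \<in> U \<and> smooth_fun_on A U f)"


section \<open>Tangent vectors, vector fields and tensor fields\<close>

text \<open>
  \<open>T\<^sub>mM\<close> is the space of derivations at \<open>m\<close> of the algebra of germs of smooth functions. The value
  on functions not smooth near \<open>m\<close> is fixed to be zero, so that tangent vectors are equal as
  functionals iff they are equal as derivations.
\<close>

type_synonym 'a tvec = "('a \<Rightarrow> real) \<Rightarrow> real"

definition tangent_space :: "('a::t2_space, 'e::real_inner) chart set \<Rightarrow> 'a \<Rightarrow> 'a tvec set" where
  "tangent_space A m = {v.
     (\<forall>f g. smooth_near A m f \<and> smooth_near A m g \<longrightarrow>
        v (\<lambda>x. f x + g x) = v f + v g \<and>
        v (\<lambda>x. f x * g x) = f m * v g + g m * v f) \<and>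
     (\<forall>c f. smooth_near A m f \<longrightarrow> v (\<lambda>x. c * f x) = c * v f) \<and>
     (\<forall>f g. smooth_near A m f \<and> smooth_near A m g \<and> (\<forall>\<^sub>F x in nhds m. f x = g x) \<longrightarrow> v f = v g) \<and>
     (\<forall>f. \<not> smooth_near A m f \<longrightarrow> v f = 0)}"

type_synonym 'a vfield = "'a \<Rightarrow> 'a tvec"

definition vector_fields :: "('a::t2_space, 'e::real_inner) chart set \<Rightarrow> 'a vfield set" where
  "vector_fields A = {X. (\<forall>m. X m \<in> tangent_space A m) \<and>
     (\<forall>U f. smooth_fun_on A U f \<longrightarrow> smooth_fun_on A U (\<lambda>m. X m f))}"

abbreviation eval_fields :: "'a vfield list \<Rightarrow> 'a \<Rightarrow> 'a tvec list" where
  "eval_fields Xs m \<equiv> map (\<lambda>X. X m) Xs"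

text \<open>
  A covariant tensor of order \<open>n\<close> at \<open>m\<close> is a multilinear form on lists of \<open>n\<close> tangent vectors at
  \<open>m\<close>, with value zero on all other lists.
\<close>

type_synonym 'a ctensor = "'a tvec list \<Rightarrow> real"

definition tangent_lists :: "('a::t2_space, 'e::real_inner) chart set \<Rightarrow> nat \<Rightarrow> 'a \<Rightarrow> 'a tvec list set" where
  "tangent_lists A n m = {vs. length vs = n \<and> set vs \<subseteq> tangent_space A m}"

definition tensors_at :: "('a::t2_space, 'e::real_inner) chart set \<Rightarrow> nat \<Rightarrow> 'a \<Rightarrow> 'a ctensor set" where
  "tensors_at A n m = {t.
     (\<forall>vs\<in>tangent_lists A n m. \<forall>i<n. \<forall>v\<in>tangent_space A m. \<forall>w\<in>tangent_space A m. \<forall>a b.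
        t (vs[i := (\<lambda>f. a * v f + b * w f)]) = a * t (vs[i := v]) + b * t (vs[i := w])) \<and>
     (\<forall>vs. vs \<notin> tangent_lists A n m \<longrightarrow> t vs = 0)}"

definition tensor_fields :: "('a::t2_space, 'e::real_inner) chart set \<Rightarrow> nat \<Rightarrow> ('a \<Rightarrow> 'a ctensor) set" where
  "tensor_fields A n = {\<omega>. (\<forall>m. \<omega> m \<in> tensors_at A n m) \<and>
     (\<forall>Xs. length Xs = n \<and> set Xs \<subseteq> vector_fields A \<longrightarrow>
        (\<lambda>m. \<omega> m (eval_fields Xs m)) \<in> smooth_functions A)}"


section \<open>Functions vanishing to order \<open>n\<close> and Hessian structures\<close>

definition vanishing_at :: "('a::t2_space, 'e::real_inner) chart set \<Rightarrow> 'a \<Rightarrow> ('a \<Rightarrow> real) set" where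
  "vanishing_at A m = {f. smooth_near A m f \<and> f m = 0}"

text \<open>
  The space \<open>F\<^sub>m\<^sup>n\<close>: sums of products of \<open>n\<close> elements of \<open>F\<^sub>m\<close>. As these are only defined near \<open>m\<close>,
  so is the identity between \<open>f\<close> and the sum of products.
\<close>

definition vanishing_power :: "('a::t2_space, 'e::real_inner) chart set \<Rightarrow> nat \<Rightarrow> 'a \<Rightarrow> ('a \<Rightarrow> real) set" where
  "vanishing_power A n m = {f. smooth_near A m f \<and>
     (\<exists>(N::nat) g. (\<forall>i<N. \<forall>j<n. g i j \<in> vanishing_at A m) \<and>
        (\<forall>\<^sub>F x in nhds m. f x = (\<Sum>i<N. \<Prod>j<n. g i j x)))}"

text \<open>The function \<open>X\<^sub>1 \<cdot> X\<^sub>2 \<cdots> X\<^sub>n \<cdot> f\<close> for \<open>Xs = [X\<^sub>1, \<dots>, X\<^sub>n]\<close>.\<close>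

definition iterated_action :: "'a vfield list \<Rightarrow> ('a \<Rightarrow> real) \<Rightarrow> 'a \<Rightarrow> real" where
  "iterated_action Xs f = foldr (\<lambda>X h. (\<lambda>p. X p h)) Xs f"

text \<open>
  The \<open>n\<close>-th derivative at \<open>m\<close>, where vector fields \<open>X\<^sub>i\<close> with \<open>X\<^sub>i(m) = v\<^sub>i\<close> are chosen
  arbitrarily; it is meaningful for \<open>f \<in> F\<^sub>m\<^sup>n\<close>, where the value does not depend on the choice.
\<close>

definition higher_deriv :: "('a::t2_space, 'e::real_inner) chart set \<Rightarrow> nat \<Rightarrow> ('a \<Rightarrow> real) \<Rightarrow> 'a \<Rightarrow> 'a ctensor" where
  "higher_deriv A n f m vs =
     (if vs \<in> tangent_lists A n m
      then (THE r. \<exists>Xs. set Xs \<subseteq> vector_fields A \<and> eval_fields Xs m = vs \<and>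
                        r = iterated_action Xs f m)
      else 0)"

definition hessian_structure ::
  "('a::t2_space, 'e::real_inner) chart set \<Rightarrow> nat \<Rightarrow> (('a \<Rightarrow> real) \<Rightarrow> 'a \<Rightarrow> 'a ctensor) \<Rightarrow> bool" where
  "hessian_structure A n H \<longleftrightarrow>
     (\<forall>f\<in>smooth_functions A. H f \<in> tensor_fields A n) \<and>
     (\<forall>f\<in>smooth_functions A. \<forall>g\<in>smooth_functions A. \<forall>a b.
        H (\<lambda>x. a * f x + b * g x) = (\<lambda>m vs. a * H f m vs + b * H g m vs)) \<and>
     (\<forall>f\<in>smooth_functions A. \<forall>m. f \<in> vanishing_power A n m \<longrightarrow> H f m = higher_deriv A n f m)"


section \<open>Connections and iterated covariant derivatives\<close>

definition vf_add :: "'a vfield \<Rightarrow> 'a vfield \<Rightarrow> 'a vfield" where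
  "vf_add X Y = (\<lambda>m f. X m f + Y m f)"

definition vf_scale :: "('a \<Rightarrow> real) \<Rightarrow> 'a vfield \<Rightarrow> 'a vfield" where
  "vf_scale h X = (\<lambda>m f. h m * X m f)"

definition koszul_connection ::
  "('a::t2_space, 'e::real_inner) chart set \<Rightarrow> ('a vfield \<Rightarrow> 'a vfield \<Rightarrow> 'a vfield) \<Rightarrow> bool" where
  "koszul_connection A D \<longleftrightarrow>
     (\<forall>X\<in>vector_fields A. \<forall>Y\<in>vector_fields A. D X Y \<in> vector_fields A) \<and>
     (\<forall>X\<in>vector_fields A. \<forall>X'\<in>vector_fields A. \<forall>Y\<in>vector_fields A.
        D (vf_add X X') Y = vf_add (D X Y) (D X' Y)) \<and>
     (\<forall>X\<in>vector_fields A. \<forall>Y\<in>vector_fields A. \<forall>Y'\<in>vector_fields A.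
        D X (vf_add Y Y') = vf_add (D X Y) (D X Y')) \<and>
     (\<forall>h\<in>smooth_functions A. \<forall>X\<in>vector_fields A. \<forall>Y\<in>vector_fields A.
        D (vf_scale h X) Y = vf_scale h (D X Y)) \<and>
     (\<forall>h\<in>smooth_functions A. \<forall>X\<in>vector_fields A. \<forall>Y\<in>vector_fields A.
        D X (vf_scale h Y) = vf_add (vf_scale (\<lambda>m. X m h) Y) (vf_scale h (D X Y)))"

text \<open>
  The tensor field \<open>\<nabla>\<omega>\<close> of order \<open>n + 1\<close> for \<open>\<omega>\<close> of order \<open>n\<close>. Its value on tangent vectors
  \<open>v\<^sub>0, \<dots>, v\<^sub>n\<close> at \<open>m\<close> is the value at \<open>m\<close> of the function
  \<open>X\<^sub>0 \<cdot> (\<omega>(X\<^sub>1, \<dots>, X\<^sub>n)) - \<Sum>\<^sub>i \<omega>(X\<^sub>1, \<dots>, \<nabla>\<^bsub>X\<^sub>0\<^esub> X\<^sub>i, \<dots>, X\<^sub>n)\<close>, which is the same for all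
  vector fields with \<open>X\<^sub>i(m) = v\<^sub>i\<close>. In the list \<open>Xs\<close>, the field \<open>X\<^sub>i\<close> has index \<open>i - 1\<close>.
\<close>

definition covariant_deriv ::
  "('a::t2_space, 'e::real_inner) chart set \<Rightarrow> ('a vfield \<Rightarrow> 'a vfield \<Rightarrow> 'a vfield) \<Rightarrow> nat \<Rightarrow>
   ('a \<Rightarrow> 'a ctensor) \<Rightarrow> 'a \<Rightarrow> 'a ctensor" where
  "covariant_deriv A D n \<omega> m vs =
     (if vs \<in> tangent_lists A (Suc n) m
      then (THE r. \<exists>X Xs. X \<in> vector_fields A \<and> set Xs \<subseteq> vector_fields A \<and>
                          eval_fields (X # Xs) m = vs \<and>
                          r = X m (\<lambda>p. \<omega> p (eval_fields Xs p))
                              - (\<Sum>i<n. \<omega> m (eval_fields (Xs[i := D X (Xs ! i)]) m)))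
      else 0)"

definition differential :: "('a::t2_space, 'e::real_inner) chart set \<Rightarrow> ('a \<Rightarrow> real) \<Rightarrow> 'a \<Rightarrow> 'a ctensor" where
  "differential A f m vs = (if vs \<in> tangent_lists A 1 m then hd vs f else 0)"

text \<open>\<open>\<nabla>\<^sup>n f\<close>; only \<open>n \<ge> 1\<close> is meaningful, and the value at \<open>0\<close> is a dummy.\<close>

fun iterated_covariant_deriv ::
  "('a::t2_space, 'e::real_inner) chart set \<Rightarrow> ('a vfield \<Rightarrow> 'a vfield \<Rightarrow> 'a vfield) \<Rightarrow> nat \<Rightarrow>
   ('a \<Rightarrow> real) \<Rightarrow> 'a \<Rightarrow> 'a ctensor" where
  "iterated_covariant_deriv A D 0 f = (\<lambda>m vs. 0)"
| "iterated_covariant_deriv A D (Suc 0) f = differential A f"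
| "iterated_covariant_deriv A D (Suc (Suc n)) f =
     covariant_deriv A D (Suc n) (iterated_covariant_deriv A D (Suc n) f)"

end

theory Submission
  imports Defs
begin

text \<open>
  Expanding the recursion, \<open>\<nabla>\<^sup>n f(X\<^sub>1, \<dots>, X\<^sub>n)\<close> is \<open>X\<^sub>1 \<cdots> X\<^sub>n f\<close> plus iterated actions of fewer
  than \<open>n\<close> vector fields on \<open>f\<close>. A vector field lowers the order of vanishing at \<open>m\<close> by at most one,
  so for \<open>f \<in> F\<^sub>m\<^sup>n\<close> only the leading term survives at \<open>m\<close>. In particular the value of that term does
  not depend on the extension of the tangent vectors, because \<open>\<nabla>\<^sup>n f\<close> is a tensor field.

  That \<open>\<nabla>\<omega>\<close> is a well-defined tensor follows from its linearity over the smooth functions: cut-off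
  functions and Hadamard's lemma write a vector field vanishing at \<open>m\<close> as a finite combination of
  vector fields with smooth coefficients vanishing at \<open>m\<close>.
\<close>

section \<open>Calculus of smooth maps\<close>

text \<open>The model space is only known to be an inner product space with a finite spanning set.
  Compactness of balls, regularity of composites and differentiation of integrals are therefore all
  reduced to finite sums over an expansion \<open>coord_frame\<close>, which also covers dimension
  zero. Tensors take tangent vectors, whereas the formula for the covariant derivative takes global
  vector fields. \<open>covariant_deriv\<close> and \<open>higher_deriv\<close> bridge the gap by
  definite descriptions, so nothing can be computed with them before independence of the chosen
  fields is known. The formula on fields, \<open>cov_form\<close>, is therefore studied first in its
  own right. The comparison with the iterated action cannot be made at m alone, since every further
  derivative looks at a neighbourhood. It is made for functions near m, with an order of vanishing
  as bookkeeping; a surplus order j in the induction pays for the outermost vector field.\<close>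

lemma frechet_derivative_eq:
  "(f has_derivative f') (at x) \<Longrightarrow> frechet_derivative f (at x) = f'"
  using frechet_derivative_at by metis

lemma has_derivative_frechet:
  "f differentiable (at x) \<Longrightarrow> (f has_derivative frechet_derivative f (at x)) (at x)"
  by (simp add: frechet_derivative_works)

lemma frechet_derivative_cong_open:
  assumes "open S" "x \<in> S" "\<And>y. y \<in> S \<Longrightarrow> f y = g y"
  shows "(f has_derivative f') (at x) \<longleftrightarrow> (g has_derivative f') (at x)"
    "f differentiable (at x) \<longleftrightarrow> g differentiable (at x)"
    "frechet_derivative f (at x) = frechet_derivative g (at x)"
proof -
  show 1: "(f has_derivative f') (at x) \<longleftrightarrow> (g has_derivative f') (at x)" for f'
    using has_derivative_transform_within_open[of f f' x UNIV S g]
      has_derivative_transform_within_open[of g f' x UNIV S f] assms by auto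
  show "f differentiable (at x) \<longleftrightarrow> g differentiable (at x)"
    using 1 by (simp add: differentiable_def)
  show "frechet_derivative f (at x) = frechet_derivative g (at x)"
    using 1 by (simp add: frechet_derivative_def)
qed

text \<open>\<open>Ck_on\<close> uses two-sided derivatives in the whole space, which see values
  around each point. Openness of \<open>S\<close> keeps those values inside the set on which the
  functions agree.\<close>

lemma Ck_on_cong:
  assumes "open S" "\<And>x. x \<in> S \<Longrightarrow> f x = g x"
  shows "Ck_on k S f \<longleftrightarrow> Ck_on k S g"
  using assms(2)
proof (induction k arbitrary: f g)
  case 0
  then show ?case by (simp cong: continuous_on_cong)
next
  case (Suc k)
  have "f differentiable (at x) \<longleftrightarrow> g differentiable (at x)"
    "frechet_derivative f (at x) = frechet_derivative g (at x)" if "x \<in> S" for x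
    using frechet_derivative_cong_open(2,3)[OF assms(1) that, of f g] Suc.prems by auto
  moreover have "Ck_on k S (\<lambda>x. frechet_derivative f (at x) v) \<longleftrightarrow> Ck_on k S (\<lambda>x. frechet_derivative g (at x) v)" for v
    by (rule Suc.IH) (simp add: calculation)
  ultimately show ?case by simp
qed

text \<open>Regularity can be read off any explicit formula for the derivative. Most closure
  properties below are inductions on k through this rule.\<close>

lemma Ck_on_SucI:
  assumes "open S" "\<And>x. x \<in> S \<Longrightarrow> (f has_derivative f' x) (at x)"
    "\<And>v. Ck_on k S (\<lambda>x. f' x v)"
  shows "Ck_on (Suc k) S f"
proof -
  have "frechet_derivative f (at x) = f' x" if "x \<in> S" for x
    using frechet_derivative_eq[OF assms(2)[OF that]] .
  then have "Ck_on k S (\<lambda>x. frechet_derivative f (at x) v)" for v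
    using Ck_on_cong[OF assms(1), of "\<lambda>x. frechet_derivative f (at x) v" "\<lambda>x. f' x v"] assms(3) by simp
  then show ?thesis using assms(2) by (auto simp: differentiable_def)
qed

lemma Ck_on_SucD:
  assumes "Ck_on (Suc k) S f"
  shows "x \<in> S \<Longrightarrow> (f has_derivative frechet_derivative f (at x)) (at x)"
    "Ck_on k S (\<lambda>x. frechet_derivative f (at x) v)"
  using assms by (auto intro: has_derivative_frechet)

lemma Ck_on_Suc_imp: "Ck_on (Suc k) S f \<Longrightarrow> Ck_on k S f"
proof (induction k arbitrary: f)
  case 0
  then show ?case
    by (auto intro!: continuous_at_imp_continuous_on differentiable_imp_continuous_within)
next
  case (Suc k)
  then show ?case using Ck_on.simps(2) by blast
qed

lemma Ck_on_imp_continuous_on: "Ck_on k S f \<Longrightarrow> continuous_on S f"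
  by (induction k) (use Ck_on_Suc_imp in \<open>auto simp del: Ck_on.simps(2)\<close>)

lemma Ck_on_mono: "Ck_on k S f \<Longrightarrow> T \<subseteq> S \<Longrightarrow> Ck_on k T f"
  by (induction k arbitrary: f) (auto intro: continuous_on_subset)

lemma Ck_on_Union:
  assumes "\<And>W. W \<in> C \<Longrightarrow> open W" "\<And>W. W \<in> C \<Longrightarrow> Ck_on k W f"
  shows "Ck_on k (\<Union>C) f"
  using assms(2)
proof (induction k arbitrary: f)
  case 0
  then show ?case using assms(1) by (auto intro: continuous_on_open_Union)
qed auto

lemma Ck_on_const: "Ck_on k S (\<lambda>x. c)"
  by (induction k arbitrary: c) (auto simp: frechet_derivative_const)

lemma Ck_on_bounded_linear:
  assumes "bounded_linear L" "open S" "Ck_on k S f"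
  shows "Ck_on k S (\<lambda>x. L (f x))"
  using assms(3)
proof (induction k arbitrary: f)
  case 0
  then show ?case
    using bounded_linear.continuous_on[OF assms(1)] by auto
next
  case (Suc k)
  show ?case
    by (rule Ck_on_SucI[OF assms(2)])
      (use bounded_linear.has_derivative[OF assms(1)] Ck_on_SucD[OF Suc.prems] Suc.IH in blast)+
qed

lemma Ck_on_linear:
  assumes "bounded_linear L" "open S"
  shows "Ck_on k S L"
proof (cases k)
  case 0
  then show ?thesis using assms(1) by (simp add: linear_continuous_on)
next
  case (Suc j)
  then show ?thesis
    using Ck_on_SucI[OF assms(2), of L "\<lambda>_. L" j] bounded_linear_imp_has_derivative[OF assms(1)] Ck_on_const
    by blast
qed

lemma Ck_on_add:
  assumes "open S" "Ck_on k S f" "Ck_on k S g"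
  shows "Ck_on k S (\<lambda>x. f x + g x)"
  using assms(2,3)
proof (induction k arbitrary: f g)
  case 0
  then show ?case by (auto intro: continuous_on_add)
next
  case (Suc k)
  show ?case
    by (rule Ck_on_SucI[OF assms(1)])
      (use has_derivative_add Ck_on_SucD[OF Suc.prems(1)] Ck_on_SucD[OF Suc.prems(2)] Suc.IH in blast)+
qed

lemma Ck_on_sum:
  assumes "open S" "\<And>i. i \<in> I \<Longrightarrow> Ck_on k S (f i)"
  shows "Ck_on k S (\<lambda>x. \<Sum>i\<in>I. f i x)"
  using assms(2)
  by (induction I rule: infinite_finite_induct) (auto intro!: Ck_on_const Ck_on_add[OF assms(1)])

text \<open>One argument serves ordinary products, scalar multiples and inner products. The product
  rule gives two bilinear terms, each pairing one function with a derivative of the other; the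
  undifferentiated factor is first lowered to order k.\<close>

lemma Ck_on_bilinear:
  assumes "bounded_bilinear B" "open S" "Ck_on k S f" "Ck_on k S g"
  shows "Ck_on k S (\<lambda>x. B (f x) (g x))"
  using assms(3,4)
proof (induction k arbitrary: f g)
  case 0
  then show ?case
    using bounded_bilinear.continuous_on[OF assms(1)] by auto
next
  case (Suc k)
  note f = Ck_on_SucD[OF Suc.prems(1)] Ck_on_Suc_imp[OF Suc.prems(1)]
  note g = Ck_on_SucD[OF Suc.prems(2)] Ck_on_Suc_imp[OF Suc.prems(2)]
  show ?case
    by (rule Ck_on_SucI[OF assms(2) bounded_bilinear.FDERIV[OF assms(1) f(1) g(1)]])
      (auto intro!: Ck_on_add[OF assms(2)] Suc.IH f g)
qed

lemmas Ck_on_mult = Ck_on_bilinear[OF bounded_bilinear_mult]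
lemmas Ck_on_scaleR = Ck_on_bilinear[OF bounded_bilinear_scaleR]

section \<open>Finite expansions, compact balls and the chain rule\<close>

text \<open>
  Coordinates with respect to an orthonormal basis; every orthonormal basis of a finite-dimensional
  space qualifies, in particular \<open>{}\<close> in dimension zero.
\<close>

definition coord_frame :: "'e::real_inner set \<Rightarrow> bool" where
  "coord_frame B \<longleftrightarrow> finite B \<and> (\<forall>x. (\<Sum>b\<in>B. (x \<bullet> b) *\<^sub>R b) = x)"

text \<open>The composition rule below asks for a frame of the intermediate space; this supplies it
  when a real-valued map is followed by a function of one real variable.\<close>

lemma coord_frame_real: "coord_frame {1::real}"
  by (simp add: coord_frame_def)

text \<open>An orthogonal spanning set is normalised. The expansion then holds for each basis vector
  and extends to the span by linearity.\<close>

lemma coord_frame_exists: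
  fixes C :: "'e::real_inner set"
  assumes "finite C" "span C = UNIV"
  shows "\<exists>B::'e set. coord_frame B"
proof -
  obtain B :: "'e set" where B: "finite B" "span B = UNIV" "pairwise orthogonal B"
    using basis_orthogonal[OF assms(1)] assms(2) by metis
  \<comment> \<open>The orthogonal family may contain the zero vector, which cannot be normalised;
    dropping it leaves the span unchanged.\<close>
  define B' where "B' = (\<lambda>b. b /\<^sub>R norm b) ` (B - {0})"
  have fin: "finite B'" using B(1) by (simp add: B'_def)
  have orth: "b \<bullet> c = (if b = c then 1 else 0)" if bc: "b \<in> B'" "c \<in> B'" for b c
  proof -
    obtain x y where x: "x \<in> B" "x \<noteq> 0" "b = x /\<^sub>R norm x" and y: "y \<in> B" "y \<noteq> 0" "c = y /\<^sub>R norm y"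
      using bc by (auto simp: B'_def)
    show ?thesis
    proof (cases "x = y")
      case True
      then show ?thesis using x y by (simp add: power2_norm_eq_inner[symmetric] power2_eq_square)
    next
      case False
      then have "x \<bullet> y = 0" using B(3) x(1) y(1) by (simp add: pairwise_def orthogonal_def)
      then have "b \<bullet> c = 0" using x y by simp
      moreover have "b \<bullet> b = 1" using x by (simp add: power2_norm_eq_inner[symmetric] power2_eq_square)
      ultimately show ?thesis by auto
    qed
  qed
  have "B \<subseteq> span B'"
  proof
    fix x assume x: "x \<in> B"
    show "x \<in> span B'"
    proof (cases "x = 0")
      case False
      then have "x /\<^sub>R norm x \<in> B'" using x by (auto simp: B'_def)
      then have "norm x *\<^sub>R (x /\<^sub>R norm x) \<in> span B'" using span_base span_scale by blast
      then show ?thesis using False by simp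
    qed (simp add: span_zero)
  qed
  then have sp: "span B' = UNIV"
    using B(2) by (metis UNIV_I span_mono span_span subset_antisym subset_UNIV)
  have "(\<Sum>b\<in>B'. (x \<bullet> b) *\<^sub>R b) = x" for x
  proof -
    have "x \<in> span B'" by (simp add: sp)
    then show ?thesis
    proof (induction rule: span_induct_alt)
      case (step c y z)
      have "(\<Sum>b\<in>B'. ((c *\<^sub>R y + z) \<bullet> b) *\<^sub>R b) = c *\<^sub>R (\<Sum>b\<in>B'. (y \<bullet> b) *\<^sub>R b) + (\<Sum>b\<in>B'. (z \<bullet> b) *\<^sub>R b)"
        by (simp add: inner_add_left scaleR_add_left sum.distrib scaleR_sum_right)
      moreover have "(\<Sum>b\<in>B'. (y \<bullet> b) *\<^sub>R b) = (\<Sum>b\<in>B'. if y = b then b else 0)"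
        by (rule sum.cong) (use step(1) orth in auto)
      ultimately show ?case using step fin by simp
    qed simp
  qed
  then show ?thesis using fin by (auto simp: coord_frame_def)
qed

lemma linear_coord_frame:
  assumes "coord_frame B" "linear L"
  shows "L x = (\<Sum>b\<in>B. (x \<bullet> b) *\<^sub>R L b)"
proof -
  have "L x = L (\<Sum>b\<in>B. (x \<bullet> b) *\<^sub>R b)" using assms(1) by (simp add: coord_frame_def)
  then show ?thesis using assms(2) by (simp add: linear_sum linear_scale)
qed

text \<open>A closed ball is a closed subset of a parallelepiped, and a parallelepiped is a finite
  sum of compact segments.\<close>

lemma compact_cball_coord_frame:
  assumes "coord_frame (B :: 'e::real_inner set)"
  shows "compact (cball (a::'e) r)"
proof -
  have fin: "finite B" using assms by (simp add: coord_frame_def)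
  \<comment> \<open>The bound \<open>r * norm b\<close> is the Cauchy-Schwarz estimate of a
    coordinate on the ball; \<open>coord_frame\<close> does not say that its members are unit
    vectors.\<close>
  define K where "K C = {\<Sum>b\<in>C. c b *\<^sub>R b | c. \<forall>b\<in>C. \<bar>c b\<bar> \<le> r * norm b}" for C :: "'e set"
  have "compact (K C)" if "finite C" for C
    using that
  proof (induction C)
    case empty
    then show ?case by (simp add: K_def)
  next
    case (insert b C)
    let ?I = "(\<lambda>t. t *\<^sub>R b) ` {- (r * norm b)..r * norm b}"
    have "K (insert b C) = {x + y | x y. x \<in> ?I \<and> y \<in> K C}"
    proof (intro equalityI subsetI)
      fix z assume "z \<in> K (insert b C)"
      then obtain c where c: "z = (\<Sum>b\<in>insert b C. c b *\<^sub>R b)" "\<forall>b\<in>insert b C. \<bar>c b\<bar> \<le> r * norm b"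
        by (auto simp: K_def)
      then have "z = c b *\<^sub>R b + (\<Sum>b\<in>C. c b *\<^sub>R b)" using insert by simp
      moreover have "c b *\<^sub>R b \<in> ?I" using c(2) by (auto simp: abs_le_iff)
      ultimately show "z \<in> {x + y | x y. x \<in> ?I \<and> y \<in> K C}" using c(2) by (auto simp: K_def)
    next
      fix z assume "z \<in> {x + y | x y. x \<in> ?I \<and> y \<in> K C}"
      then obtain t c where t: "z = t *\<^sub>R b + (\<Sum>b\<in>C. c b *\<^sub>R b)" "\<bar>t\<bar> \<le> r * norm b"
          "\<forall>b\<in>C. \<bar>c b\<bar> \<le> r * norm b"
        by (auto simp: K_def abs_le_iff)
      have "(\<Sum>b\<in>C. c b *\<^sub>R b) = (\<Sum>x\<in>C. (c(b := t)) x *\<^sub>R x)"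
        by (rule sum.cong) (use insert in auto)
      then have "z = (\<Sum>x\<in>insert b C. (c(b := t)) x *\<^sub>R x)" using t insert by simp
      moreover have "\<forall>x\<in>insert b C. \<bar>(c(b := t)) x\<bar> \<le> r * norm x" using t by auto
      ultimately show "z \<in> K (insert b C)" unfolding K_def by blast
    qed
    moreover have "compact ?I"
      by (intro compact_continuous_image continuous_intros) simp
    ultimately show ?case by (simp only: compact_sums[OF _ insert.IH])
  qed
  then have cK: "compact (K B)" using fin by blast
  have "cball (0::'e) r \<subseteq> K B"
  proof
    fix x :: 'e assume x: "x \<in> cball 0 r"
    have "x = (\<Sum>b\<in>B. (x \<bullet> b) *\<^sub>R b)" using assms by (simp add: coord_frame_def)
    moreover have "\<bar>x \<bullet> b\<bar> \<le> r * norm b" for b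
      using Cauchy_Schwarz_ineq2[of x b] x mult_right_mono[of "norm x" r "norm b"] by auto
    ultimately show "x \<in> K B" unfolding K_def by blast
  qed
  then have "compact (cball (0::'e) r)"
    by (metis cK closed_cball compact_Int_closed inf.absorb_iff2)
  then have "compact ((+) a ` cball 0 r)" by (rule compact_translation)
  then show ?thesis by simp
qed

text \<open>In the chain rule the derivative of g is applied to a direction that varies with x,
  which the induction hypothesis cannot treat. Expanding that direction in the frame leaves
  derivatives of g in fixed directions, with coefficients that are derivatives of f.\<close>

lemma Ck_on_compose:
  fixes f :: "'a::real_normed_vector \<Rightarrow> 'e::real_inner" and g :: "'e \<Rightarrow> 'c::real_normed_vector"
  assumes B: "coord_frame (B :: 'e set)" and "open S" "open T" "f ` S \<subseteq> T" "Ck_on k S f" "Ck_on k T g"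
  shows "Ck_on k S (\<lambda>x. g (f x))"
  using assms(4-6)
proof (induction k arbitrary: f g)
  case 0
  then show ?case by (auto intro: continuous_on_compose2)
next
  case (Suc k)
  note f = Ck_on_SucD[OF Suc.prems(2)] Ck_on_Suc_imp[OF Suc.prems(2)]
  note g = Ck_on_SucD[OF Suc.prems(3)]
  have fT: "f x \<in> T" if "x \<in> S" for x using that Suc.prems(1) by auto
  let ?f' = "\<lambda>x v. frechet_derivative f (at x) v"
  have "((\<lambda>x. g (f x)) has_derivative
      (\<lambda>v. \<Sum>b\<in>B. (?f' x v \<bullet> b) *\<^sub>R frechet_derivative g (at (f x)) b)) (at x)" if x: "x \<in> S" for x
  proof -
    have "((\<lambda>x. g (f x)) has_derivative (\<lambda>v. frechet_derivative g (at (f x)) (?f' x v))) (at x)"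
      using has_derivative_compose[OF f(1)[OF x] g(1)[OF fT[OF x]]] .
    then show ?thesis
      by (rule has_derivative_eq_rhs)
        (rule ext, rule linear_coord_frame[OF B has_derivative_linear[OF g(1)[OF fT[OF x]]]])
  qed
  then show ?case
  proof (rule Ck_on_SucI[OF assms(2)])
    show "Ck_on k S (\<lambda>x. \<Sum>b\<in>B. (?f' x v \<bullet> b) *\<^sub>R frechet_derivative g (at (f x)) b)" for v
      by (intro Ck_on_sum[OF assms(2)] Ck_on_scaleR[OF assms(2)]
          Ck_on_bounded_linear[OF bounded_linear_inner_left assms(2) f(2)]
          Suc.IH[OF Suc.prems(1) f(3) g(2)])
  qed
qed

section \<open>Smooth maps: the same closure properties for all orders\<close>

lemma smooth_on_cong:
  "open S \<Longrightarrow> (\<And>x. x \<in> S \<Longrightarrow> f x = g x) \<Longrightarrow> smooth_on S f \<longleftrightarrow> smooth_on S g"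
  using Ck_on_cong unfolding smooth_on_def by blast

lemma smooth_on_mono: "smooth_on S f \<Longrightarrow> T \<subseteq> S \<Longrightarrow> smooth_on T f"
  using Ck_on_mono unfolding smooth_on_def by blast

lemma smooth_on_Union:
  "(\<And>W. W \<in> C \<Longrightarrow> open W) \<Longrightarrow> (\<And>W. W \<in> C \<Longrightarrow> smooth_on W f) \<Longrightarrow> smooth_on (\<Union>C) f"
  unfolding smooth_on_def by (simp add: Ck_on_Union)

lemma smooth_on_const: "smooth_on S (\<lambda>x. c)"
  by (simp add: smooth_on_def Ck_on_const)

lemma smooth_on_linear: "bounded_linear L \<Longrightarrow> open S \<Longrightarrow> smooth_on S L"
  by (simp add: smooth_on_def Ck_on_linear)

lemma smooth_on_add: "open S \<Longrightarrow> smooth_on S f \<Longrightarrow> smooth_on S g \<Longrightarrow> smooth_on S (\<lambda>x. f x + g x)"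
  by (simp add: smooth_on_def Ck_on_add)

lemma smooth_on_bilinear:
  "bounded_bilinear B \<Longrightarrow> open S \<Longrightarrow> smooth_on S f \<Longrightarrow> smooth_on S g \<Longrightarrow> smooth_on S (\<lambda>x. B (f x) (g x))"
  by (simp add: smooth_on_def Ck_on_bilinear)

lemmas smooth_on_mult = smooth_on_bilinear[OF bounded_bilinear_mult]

lemma smooth_on_compose:
  fixes f :: "'a::real_normed_vector \<Rightarrow> 'e::real_inner" and g :: "'e \<Rightarrow> 'c::real_normed_vector"
  assumes "coord_frame (B :: 'e set)" "open S" "open T" "f ` S \<subseteq> T" "smooth_on S f" "smooth_on T g"
  shows "smooth_on S (\<lambda>x. g (f x))"
  using assms(5,6) Ck_on_compose[OF assms(1-4)] unfolding smooth_on_def by blast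

lemma smooth_on_has_derivative:
  "smooth_on S f \<Longrightarrow> x \<in> S \<Longrightarrow> (f has_derivative frechet_derivative f (at x)) (at x)"
  using Ck_on_SucD(1) unfolding smooth_on_def by blast

lemma smooth_on_frechet_derivative:
  "smooth_on S f \<Longrightarrow> smooth_on S (\<lambda>x. frechet_derivative f (at x) v)"
  using Ck_on_SucD(2) unfolding smooth_on_def by blast

subsection \<open>A flat function\<close>

text \<open>The power of 1/t makes the family closed under differentiation up to linear
  combinations, so that smoothness of the standard function exp(-1/t) follows by an induction over
  all members at once.\<close>

definition flat_exp :: "nat \<Rightarrow> real \<Rightarrow> real" where
  "flat_exp n t = (if t > 0 then (1 / t) ^ n * exp (- (1 / t)) else 0)"

lemma flat_exp_tendsto_0: "(flat_exp n \<longlongrightarrow> 0) (at 0)"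
proof -
  have "((\<lambda>t::real. (1 / t) ^ n / exp (1 / t)) \<longlongrightarrow> 0) (at_right 0)"
    using filterlim_compose[OF tendsto_power_div_exp_0[of n] filterlim_inverse_at_top_right]
    by (simp add: divide_inverse)
  then have "(flat_exp n \<longlongrightarrow> 0) (at_right 0)"
    by (rule Lim_transform_eventually)
      (auto simp: flat_exp_def exp_minus divide_inverse eventually_at_right_less
         eventually_at_filter)
  moreover have "(flat_exp n \<longlongrightarrow> 0) (at_left 0)"
    by (rule tendsto_eventually) (auto simp: flat_exp_def eventually_at_filter)
  ultimately show ?thesis by (simp add: filterlim_split_at_real)
qed

lemma flat_exp_has_derivative:
  "(flat_exp n has_real_derivative flat_exp (n + 2) t - n * flat_exp (n + 1) t) (at t)"
proof -
  consider "t > 0" | "t < 0" | "t = 0" by linarith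
  then show ?thesis
  proof cases
    case 1
    have inv: "((\<lambda>t. 1 / t) has_real_derivative - (1 / t * (1 / t))) (at t)"
      using 1 by (auto intro!: derivative_eq_intros)
    have "((\<lambda>t. (1 / t) ^ n) has_real_derivative - (n * (1 / t) ^ (n + 1))) (at t)"
      by (rule DERIV_cong[OF DERIV_power[OF inv]]) (cases n, auto simp: power_one_over)
    moreover have "((\<lambda>t. exp (- (1 / t))) has_real_derivative exp (- (1 / t)) * (1 / t * (1 / t))) (at t)"
      by (rule DERIV_cong[OF DERIV_fun_exp[OF DERIV_minus[OF inv]]]) simp
    ultimately have "((\<lambda>t. (1 / t) ^ n * exp (- (1 / t))) has_real_derivative
        flat_exp (n + 2) t - n * flat_exp (n + 1) t) (at t)"
      by (rule DERIV_cong[OF DERIV_mult]) (use 1 in \<open>simp add: flat_exp_def algebra_simps\<close>)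
    then show ?thesis
      by (rule has_field_derivative_transform_within_open[of _ _ _ "{0<..}"])
        (use 1 in \<open>auto simp: flat_exp_def\<close>)
  next
    case 2
    have "((\<lambda>t. 0) has_real_derivative flat_exp (n + 2) t - n * flat_exp (n + 1) t) (at t)"
      using 2 by (simp add: flat_exp_def)
    then show ?thesis
      by (rule has_field_derivative_transform_within_open[of _ _ _ "{..<0}"])
        (use 2 in \<open>auto simp: flat_exp_def\<close>)
  next
    case 3
    \<comment> \<open>For nonzero h this difference quotient is \<open>flat_exp (Suc n) h\<close>,
      so it tends to 0 as well.\<close>
    have "((\<lambda>h. (flat_exp n (0 + h) - flat_exp n 0) / h) \<longlongrightarrow> 0) (at 0)"
      by (rule Lim_transform_eventually[OF flat_exp_tendsto_0[of "Suc n"]])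
        (auto simp: flat_exp_def eventually_at_filter field_simps)
    then show ?thesis using 3 by (simp add: DERIV_def flat_exp_def)
  qed
qed

lemma smooth_on_flat_exp: "smooth_on UNIV (flat_exp n)"
proof -
  have "Ck_on k UNIV (flat_exp n)" for k
  proof (induction k arbitrary: n)
    case 0
    show ?case
      using DERIV_isCont[OF flat_exp_has_derivative]
      by (simp add: continuous_at_imp_continuous_on)
  next
    case (Suc k)
    show ?case
    proof (rule Ck_on_SucI)
      show "(flat_exp n has_derivative (*) (flat_exp (n + 2) t + (- real n) * flat_exp (n + 1) t)) (at t)" for t
        using flat_exp_has_derivative[of n t] by (simp add: has_field_derivative_def)
      show "Ck_on k UNIV (\<lambda>t. (flat_exp (n + 2) t + (- real n) * flat_exp (n + 1) t) * v)" for v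
        by (intro Ck_on_mult Ck_on_add Ck_on_const open_UNIV Suc)
    qed simp
  qed
  then show ?thesis by (simp add: smooth_on_def)
qed

subsection \<open>Hadamard's lemma\<close>

text \<open>Differentiating \<open>F (a + t *\<^sub>R (x - a))\<close> in x brings out a factor t.
  The power \<open>t ^ j\<close> is carried along so that the derivative is again an integral of the
  same form, now for a directional derivative of F.\<close>

lemma has_derivative_integral_dilation:
  fixes F :: "'e::real_inner \<Rightarrow> real"
  assumes B: "coord_frame (B :: 'e set)" and "Ck_on 1 (ball a r) F" and x: "x \<in> ball a r"
  shows "((\<lambda>x. integral {0..1} (\<lambda>t. t ^ j * F (a + t *\<^sub>R (x - a)))) has_derivative
    (\<lambda>v. integral {0..1} (\<lambda>t. t ^ Suc j * frechet_derivative F (at (a + t *\<^sub>R (x - a))) v))) (at x)"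
proof -
  text \<open>
    The library's rule for differentiating under the integral sign needs a Banach space of
    parameters, so the integral is pulled back along \<open>J\<close> to the dual space of \<open>'e\<close>.
  \<close>
  define J :: "('e \<Rightarrow>\<^sub>L real) \<Rightarrow> 'e" where "J l = (\<Sum>b\<in>B. blinfun_apply l b *\<^sub>R b)" for l
  define I :: "'e \<Rightarrow> ('e \<Rightarrow>\<^sub>L real)" where "I x = blinfun_inner_right x" for x
  have JI: "J (I x) = x" for x using B by (simp add: J_def I_def coord_frame_def)
  have blJ: "bounded_linear J" unfolding J_def by (intro bounded_linear_intros)
  have blI: "bounded_linear I" unfolding I_def by (rule bounded_linear_blinfun_inner_right)
  define E :: "'e \<Rightarrow> (('e \<Rightarrow>\<^sub>L real) \<Rightarrow>\<^sub>L real)" where "E b = Blinfun (\<lambda>l. blinfun_apply l b)" for b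
  have E: "blinfun_apply (E b) l = blinfun_apply l b" for b l
    unfolding E_def by (subst bounded_linear_Blinfun_apply) (auto intro: bounded_linear_intros)
  \<comment> \<open>The preimage of the ball in the parameter space. Convexity is demanded by
    \<open>leibniz_rule\<close>; openness turns the derivative within \<open>U\<close> into a full
    one.\<close>
  define U where "U = J -` ball a r"
  have oU: "open U" unfolding U_def
    by (intro open_vimage open_ball linear_continuous_on[OF blJ])
  have cU: "convex U" unfolding U_def
    by (intro convex_linear_vimage convex_ball bounded_linear.linear[OF blJ])
  let ?p = "\<lambda>x t. a + t *\<^sub>R (x - a)"
  let ?F' = "\<lambda>x v. frechet_derivative F (at x) v"
  have p: "?p y t \<in> ball a r" if "y \<in> ball a r" "t \<in> {0..1}" for y t
  proof -
    have "norm (t *\<^sub>R (y - a)) \<le> norm (y - a)" using that(2) by (simp add: mult_left_le_one_le)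
    then show ?thesis using that(1) by (simp add: dist_norm norm_minus_commute)
  qed
  have F: "(F has_derivative ?F' y) (at y)" if "y \<in> ball a r" for y
    using Ck_on_SucD(1)[of 0 "ball a r" F y] assms(2) that by simp
  have contF': "continuous_on (ball a r) (\<lambda>y. ?F' y v)" for v
    using assms(2) by simp
  have contF: "continuous_on (ball a r) F"
    using F has_derivative_continuous by (blast intro: continuous_at_imp_continuous_on)
  have cont: "continuous_on (U \<times> {0..1}) (\<lambda>(l, t). g (?p (J l) t))"
    if "continuous_on (ball a r) g" for g :: "'e \<Rightarrow> real"
    unfolding case_prod_unfold
  proof (rule continuous_on_compose2[OF that])
    show "continuous_on (U \<times> {0..1}) (\<lambda>x. ?p (J (fst x)) (snd x))"
      by (intro continuous_intros bounded_linear.continuous_on[OF blJ])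
    show "(\<lambda>x. ?p (J (fst x)) (snd x)) ` (U \<times> {0..1}) \<subseteq> ball a r"
      using p by (auto simp: U_def simp del: mem_ball)
  qed
  have cont_Pair: "continuous_on {0..1::real} (\<lambda>t. (l, t))" for l :: "'e \<Rightarrow>\<^sub>L real"
    by (rule continuous_on_Pair[OF continuous_on_const continuous_on_id])
  have cont1: "continuous_on {0..1} (\<lambda>t. g (?p (J l) t))"
    if "continuous_on (ball a r) g" "l \<in> U" for g :: "'e \<Rightarrow> real" and l
    using continuous_on_compose2[OF cont[OF that(1)] cont_Pair] that(2) by auto
  \<comment> \<open>The derivative has to be continuous as a map into the bounded linear operators.
    Over the frame it is a combination of the fixed evaluations \<open>E b\<close> with scalar
    coefficients, whose continuity is known.\<close>
  define f' where "f' l t = (\<Sum>b\<in>B. (t ^ Suc j * ?F' (?p (J l) t) b) *\<^sub>R E b)" for l t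
  have f': "blinfun_apply (f' l t) k = t ^ Suc j * ?F' (?p (J l) t) (J k)" if "l \<in> U" "t \<in> {0..1}" for l t k
  proof -
    have "J l \<in> ball a r" using that by (simp add: U_def)
    then have "linear (?F' (?p (J l) t))"
      using F[OF p[OF _ that(2)]] has_derivative_linear by blast
    then have "?F' (?p (J l) t) (J k) = (\<Sum>b\<in>B. blinfun_apply k b * ?F' (?p (J l) t) b)"
      unfolding J_def by (simp add: linear_sum linear_scale)
    then show ?thesis
      by (simp add: f'_def blinfun.sum_left blinfun.scaleR_left E sum_distrib_left mult_ac)
  qed
  have xU: "I x \<in> U" using x JI by (simp add: U_def)
  have cf': "continuous_on (U \<times> {0..1}) (\<lambda>(l, t). f' l t)"
    unfolding f'_def case_prod_unfold
    by (intro continuous_intros cont[OF contF', unfolded case_prod_unfold])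
  have "((\<lambda>l. integral (cbox 0 1) (\<lambda>t. t ^ j * F (?p (J l) t))) has_derivative
      blinfun_apply (integral (cbox 0 1) (f' (I x)))) (at (I x) within U)"
  proof (rule leibniz_rule[OF _ _ _ xU cU])
    show "continuous_on (U \<times> cbox 0 1) (\<lambda>(l, t). f' l t)" using cf' by (simp add: cbox_interval)
    fix l assume l: "l \<in> U"
    show "(\<lambda>t. t ^ j * F (?p (J l) t)) integrable_on cbox 0 1"
      by (intro integrable_continuous continuous_intros) (use cont1[OF contF l] in \<open>simp add: cbox_interval\<close>)
    fix t :: real assume "t \<in> cbox 0 1"
    then have t: "t \<in> {0..1}" by (simp add: cbox_interval)
    have "J l \<in> ball a r" using l by (simp add: U_def)
    have "((\<lambda>l. ?p (J l) t) has_derivative (\<lambda>k. t *\<^sub>R J k)) (at l)"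
      by (auto intro!: derivative_eq_intros bounded_linear_imp_has_derivative[OF blJ])
    from has_derivative_compose[where f = "\<lambda>l. ?p (J l) t" and g = F, OF this F[OF p[OF \<open>J l \<in> ball a r\<close> t]]]
    have "((\<lambda>l. F (?p (J l) t)) has_derivative (\<lambda>k. ?F' (?p (J l) t) (t *\<^sub>R J k))) (at l)" .
    then have "((\<lambda>l. t ^ j * F (?p (J l) t)) has_derivative (\<lambda>k. t ^ j * ?F' (?p (J l) t) (t *\<^sub>R J k))) (at l)"
      by (rule has_derivative_mult_right)
    moreover have "(\<lambda>k. t ^ j * ?F' (?p (J l) t) (t *\<^sub>R J k)) = blinfun_apply (f' l t)"
      using f'[OF l t] linear_scale[OF has_derivative_linear[OF F[OF p[OF \<open>J l \<in> ball a r\<close> t]]]]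
      by (auto simp: fun_eq_iff)
    ultimately show "((\<lambda>l. t ^ j * F (?p (J l) t)) has_derivative blinfun_apply (f' l t)) (at l within U)"
      by (simp add: has_derivative_at_withinI)
  qed
  then have "((\<lambda>l. integral {0..1} (\<lambda>t. t ^ j * F (?p (J l) t))) has_derivative
      blinfun_apply (integral {0..1} (f' (I x)))) (at (I x))"
    using at_within_open[OF xU oU] by (simp add: cbox_interval)
  from has_derivative_compose[OF bounded_linear_imp_has_derivative[OF blI] this]
  have D: "((\<lambda>x. integral {0..1} (\<lambda>t. t ^ j * F (?p x t))) has_derivative
      (\<lambda>v. blinfun_apply (integral {0..1} (f' (I x))) (I v))) (at x)"
    by (simp add: JI)
  have "f' (I x) integrable_on {0..1}"
    using continuous_on_compose2[OF cf' cont_Pair, of "I x"] xU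
    by (auto intro!: integrable_continuous_interval)
  then have "blinfun_apply (integral {0..1} (f' (I x))) (I v) =
      integral {0..1} (\<lambda>t. t ^ Suc j * ?F' (?p x t) v)" for v
    by (subst blinfun_apply_integral) (auto intro!: integral_cong simp: f'[OF xU] JI simp del: power_Suc)
  with D show ?thesis by simp
qed

lemma Ck_on_integral_dilation:
  fixes F :: "'e::real_inner \<Rightarrow> real"
  assumes B: "coord_frame (B :: 'e set)" and "Ck_on k (ball a r) F"
  shows "Ck_on k (ball a r) (\<lambda>x. integral {0..1} (\<lambda>t. t ^ j * F (a + t *\<^sub>R (x - a))))"
  using assms(2)
proof (induction k arbitrary: F j)
  case 0
  have p: "a + t *\<^sub>R (y - a) \<in> ball a r" if "y \<in> ball a r" "t \<in> {0..1}" for y and t :: real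
  proof -
    have "norm (t *\<^sub>R (y - a)) \<le> norm (y - a)" using that(2) by (simp add: mult_left_le_one_le)
    then show ?thesis using that(1) by (simp add: dist_norm norm_minus_commute)
  qed
  have "continuous_on (ball a r \<times> {0..1}) (\<lambda>z. F (a + snd z *\<^sub>R (fst z - a)))"
    by (rule continuous_on_compose2[of "ball a r" F])
      (use 0 p in \<open>auto intro!: continuous_intros simp del: mem_ball\<close>)
  then have "continuous_on (ball a r \<times> cbox 0 1) (\<lambda>(x, t). t ^ j * F (a + t *\<^sub>R (x - a)))"
    unfolding case_prod_unfold cbox_interval by (intro continuous_intros)
  from integral_continuous_on_param[OF this] show ?case by (simp add: cbox_interval)
next
  case (Suc k)
  have "Ck_on 1 (ball a r) F"
  proof -
    have "Ck_on k (ball a r) (\<lambda>x. frechet_derivative F (at x) v)" for v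
      using Suc.prems by simp
    then have "continuous_on (ball a r) (\<lambda>x. frechet_derivative F (at x) v)" for v
      by (rule Ck_on_imp_continuous_on)
    then show ?thesis using Suc.prems by simp
  qed
  from has_derivative_integral_dilation[OF B this] show ?case
    by (rule Ck_on_SucI[OF open_ball]) (auto intro!: Suc.IH Ck_on_SucD(2)[OF Suc.prems] simp del: power_Suc)
qed

text \<open>Integrate the derivative of \<open>F\<close> along the segment from a to x. The function
  \<open>g b\<close> is the mean of the directional derivative along b over that segment, hence
  equals the derivative itself at a; its smoothness is the dilation lemma with exponent 0.\<close>

lemma smooth_on_hadamard:
  fixes F :: "'e::real_inner \<Rightarrow> real"
  assumes B: "coord_frame (B :: 'e set)" and F: "smooth_on (ball a r) F" and "r > 0"
  shows "\<exists>g. (\<forall>b. smooth_on (ball a r) (g b)) \<and> (\<forall>b. g b a = frechet_derivative F (at a) b) \<and>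
    (\<forall>x\<in>ball a r. F x = F a + (\<Sum>b\<in>B. ((x - a) \<bullet> b) * g b x))"
proof -
  let ?p = "\<lambda>x t. a + t *\<^sub>R (x - a)"
  let ?F' = "\<lambda>x v. frechet_derivative F (at x) v"
  define g where "g b x = integral {0..1} (\<lambda>t. ?F' (?p x t) b)" for b x
  have 1: "smooth_on (ball a r) (g b)" for b
    using smooth_on_frechet_derivative[OF F, of b] Ck_on_integral_dilation[OF B, of _ a r "\<lambda>x. ?F' x b" 0]
    by (simp add: smooth_on_def g_def[abs_def])
  have 2: "g b a = ?F' a b" for b by (simp add: g_def)
  have 3: "F x = F a + (\<Sum>b\<in>B. ((x - a) \<bullet> b) * g b x)" if x: "x \<in> ball a r" for x
  proof -
  have p: "?p x t \<in> ball a r" if "t \<in> {0..1}" for t :: real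
  proof -
    have "norm (t *\<^sub>R (x - a)) \<le> norm (x - a)" using that by (simp add: mult_left_le_one_le)
    then show ?thesis using x by (simp add: dist_norm norm_minus_commute)
  qed
  have F': "((\<lambda>t. F (?p x t)) has_vector_derivative ?F' (?p x t) (x - a)) (at t within {0..1})"
    if t: "t \<in> {0..1}" for t
  proof -
    have "((\<lambda>t. F (?p x t)) has_derivative (\<lambda>s. ?F' (?p x t) (s *\<^sub>R (x - a)))) (at t within {0..1})"
      by (rule has_derivative_compose[where f = "?p x" and g = F, OF _ smooth_on_has_derivative[OF F p[OF t]]])
        (auto intro!: derivative_eq_intros)
    then show ?thesis
      using linear_scale[OF has_derivative_linear[OF smooth_on_has_derivative[OF F p[OF t]]]]
      by (simp add: has_vector_derivative_def)
  qed
  have cF': "continuous_on {0..1} (\<lambda>t. ?F' (?p x t) b)" for b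
  proof (rule continuous_on_compose2[where f = "?p x" and g = "\<lambda>x. ?F' x b"])
    show "continuous_on (ball a r) (\<lambda>x. ?F' x b)"
      using smooth_on_frechet_derivative[OF F, of b] unfolding smooth_on_def by (metis Ck_on.simps(1))
  qed (use p in \<open>auto intro!: continuous_intros simp del: mem_ball\<close>)
  have "F x - F a = integral {0..1} (\<lambda>t. ?F' (?p x t) (x - a))"
    using fundamental_theorem_of_calculus[OF _ F'] by (simp add: integral_unique)
  also have "\<dots> = integral {0..1} (\<lambda>t. \<Sum>b\<in>B. ((x - a) \<bullet> b) * ?F' (?p x t) b)"
    by (rule integral_cong)
      (use linear_coord_frame[OF B has_derivative_linear[OF smooth_on_has_derivative[OF F p]]] in simp)
  also have "\<dots> = (\<Sum>b\<in>B. ((x - a) \<bullet> b) * g b x)"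
    unfolding g_def using B
    by (subst integral_sum)
      (auto simp: coord_frame_def intro!: integrable_continuous_interval continuous_intros cF')
  finally show ?thesis by simp
  qed
  from 1 2 3 show ?thesis by blast
qed

section \<open>Functions and vector fields on a manifold\<close>

locale smooth_mfd =
  fixes A :: "('a::t2_space, 'e::real_inner) chart set"
  assumes manifold: "smooth_manifold A"
begin

lemma ex_coord_frame: "\<exists>B :: 'e set. coord_frame B"
  using manifold coord_frame_exists unfolding smooth_manifold_def by blast

definition frame :: "'e set" where "frame = (SOME B. coord_frame B)"

lemma coord_frame_frame: "coord_frame frame"
  unfolding frame_def using ex_coord_frame by (rule someI_ex)

lemma finite_frame: "finite frame"
  using coord_frame_frame by (simp add: coord_frame_def)

section \<open>Charts and functions that are smooth on open sets\<close>

lemma chartD: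
  assumes "(V, \<phi>) \<in> A"
  shows "open V" "open (\<phi> ` V)" "homeomorphism V (\<phi> ` V) \<phi> (inv_into V \<phi>)"
    "(W, \<psi>) \<in> A \<Longrightarrow> smooth_on (\<phi> ` (V \<inter> W)) (\<psi> \<circ> inv_into V \<phi>)"
  using manifold assms unfolding smooth_manifold_def by blast+

lemma chart_inv:
  assumes "(V, \<phi>) \<in> A"
  shows "p \<in> V \<Longrightarrow> inv_into V \<phi> (\<phi> p) = p" "x \<in> \<phi> ` V \<Longrightarrow> \<phi> (inv_into V \<phi> x) = x"
    "x \<in> \<phi> ` V \<Longrightarrow> inv_into V \<phi> x \<in> V"
  using chartD(3)[OF assms] by (auto simp: homeomorphism_def)

lemma chart_cover: obtains V \<phi> where "(V, \<phi>) \<in> A" "p \<in> V"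
  using manifold unfolding smooth_manifold_def by blast

lemma chart_continuous:
  assumes "(V, \<phi>) \<in> A"
  shows "continuous_on V \<phi>" "continuous_on (\<phi> ` V) (inv_into V \<phi>)"
  using chartD(3)[OF assms] by (auto simp: homeomorphism_def)

lemma chart_open_image:
  assumes "(V, \<phi>) \<in> A" "open W" "W \<subseteq> V"
  shows "open (\<phi> ` W)"
proof -
  have "openin (top_of_set V) W" using assms chartD(1) by (simp add: openin_open_eq)
  then have "openin (top_of_set (\<phi> ` V)) (\<phi> ` W)"
    using homeomorphism_imp_open_map[OF chartD(3)[OF assms(1)]] by blast
  then show ?thesis using chartD(2)[OF assms(1)] openin_open_trans by blast
qed

lemma chart_open_vimage:
  assumes "(V, \<phi>) \<in> A" "open S"
  shows "open (V \<inter> \<phi> -` S)"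
  using chart_continuous(1)[OF assms(1)] chartD(1)[OF assms(1)] assms(2)
  by (metis continuous_on_open_vimage inf_commute)

lemma smooth_fun_onD:
  assumes "smooth_fun_on A U f"
  shows "open U" "(V, \<phi>) \<in> A \<Longrightarrow> smooth_on (\<phi> ` (U \<inter> V)) (f \<circ> inv_into V \<phi>)"
  using assms unfolding smooth_fun_on_def by blast+

lemma smooth_fun_onI:
  assumes "open U" "\<And>V \<phi>. (V, \<phi>) \<in> A \<Longrightarrow> open (\<phi> ` (U \<inter> V)) \<Longrightarrow> smooth_on (\<phi> ` (U \<inter> V)) (f \<circ> inv_into V \<phi>)"
  shows "smooth_fun_on A U f"
  unfolding smooth_fun_on_def using assms chartD(1) chart_open_image
  by (metis (no_types, lifting) case_prodI2 inf_le2 open_Int)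

lemma smooth_fun_on_mono:
  "smooth_fun_on A U f \<Longrightarrow> open W \<Longrightarrow> W \<subseteq> U \<Longrightarrow> smooth_fun_on A W f"
  by (rule smooth_fun_onI) (auto intro: smooth_on_mono[OF smooth_fun_onD(2)])

lemma smooth_fun_on_cong:
  assumes "smooth_fun_on A U f" "\<And>x. x \<in> U \<Longrightarrow> f x = g x"
  shows "smooth_fun_on A U g"
proof (rule smooth_fun_onI)
  show "open U" using smooth_fun_onD(1)[OF assms(1)] .
  fix V \<phi> assume V: "(V, \<phi>) \<in> A" and o: "open (\<phi> ` (U \<inter> V))"
  have "(f \<circ> inv_into V \<phi>) x = (g \<circ> inv_into V \<phi>) x" if "x \<in> \<phi> ` (U \<inter> V)" for x
    using that assms(2) chart_inv(1)[OF V] by auto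
  then show "smooth_on (\<phi> ` (U \<inter> V)) (g \<circ> inv_into V \<phi>)"
    using smooth_fun_onD(2)[OF assms(1) V] smooth_on_cong[OF o, of "f \<circ> inv_into V \<phi>" "g \<circ> inv_into V \<phi>"]
    by simp
qed

text \<open>Gluing principle: it allows a function to be checked separately where it has a chart
  formula and where it is constantly zero.\<close>

lemma smooth_fun_on_local:
  assumes "\<And>p. p \<in> U \<Longrightarrow> \<exists>W. p \<in> W \<and> W \<subseteq> U \<and> smooth_fun_on A W f"
  shows "smooth_fun_on A U f"
proof (rule smooth_fun_onI)
  define C where "C = {W. W \<subseteq> U \<and> smooth_fun_on A W f}"
  have U: "U = \<Union>C" using assms by (auto simp: C_def)
  have oC: "open W" if "W \<in> C" for W using that smooth_fun_onD(1) by (auto simp: C_def)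
  show "open U" using U oC by auto
  fix V \<phi> assume V: "(V, \<phi>) \<in> A"
  have "smooth_on (\<Union>W\<in>C. \<phi> ` (W \<inter> V)) (f \<circ> inv_into V \<phi>)"
  proof (rule smooth_on_Union)
    fix S assume "S \<in> (\<lambda>W. \<phi> ` (W \<inter> V)) ` C"
    then obtain W where W: "W \<in> C" "S = \<phi> ` (W \<inter> V)" by blast
    show "open S" using W oC chartD(1)[OF V] chart_open_image[OF V, of "W \<inter> V"] by auto
    show "smooth_on S (f \<circ> inv_into V \<phi>)"
      using W smooth_fun_onD(2)[OF _ V] by (auto simp: C_def)
  qed
  moreover have "(\<Union>W\<in>C. \<phi> ` (W \<inter> V)) = \<phi> ` (U \<inter> V)" using U by auto
  ultimately show "smooth_on (\<phi> ` (U \<inter> V)) (f \<circ> inv_into V \<phi>)" by simp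
qed

lemma smooth_fun_on_const: "open U \<Longrightarrow> smooth_fun_on A U (\<lambda>x. c)"
  by (rule smooth_fun_onI) (auto simp: o_def smooth_on_const)

lemma smooth_fun_on_add:
  "smooth_fun_on A U f \<Longrightarrow> smooth_fun_on A U g \<Longrightarrow> smooth_fun_on A U (\<lambda>x. f x + g x)"
  by (rule smooth_fun_onI)
    (auto simp: o_def intro: smooth_fun_onD(1) smooth_on_add smooth_fun_onD(2)[unfolded o_def])

lemma smooth_fun_on_mult:
  "smooth_fun_on A U f \<Longrightarrow> smooth_fun_on A U g \<Longrightarrow> smooth_fun_on A U (\<lambda>x. f x * g x)"
  by (rule smooth_fun_onI)
    (auto simp: o_def intro: smooth_fun_onD(1) smooth_on_mult smooth_fun_onD(2)[unfolded o_def])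

lemma smooth_fun_on_cmult:
  "smooth_fun_on A U f \<Longrightarrow> smooth_fun_on A U (\<lambda>x. c * f x)"
  by (intro smooth_fun_on_mult smooth_fun_on_const) (auto dest: smooth_fun_onD(1))

lemma smooth_fun_on_diff:
  "smooth_fun_on A U f \<Longrightarrow> smooth_fun_on A U g \<Longrightarrow> smooth_fun_on A U (\<lambda>x. f x - g x)"
  using smooth_fun_on_add[of U f "\<lambda>x. -1 * g x"] smooth_fun_on_cmult[of U g "-1"] by simp

lemma smooth_fun_on_sum:
  assumes "open U" "\<And>i. i \<in> I \<Longrightarrow> smooth_fun_on A U (f i)"
  shows "smooth_fun_on A U (\<lambda>x. \<Sum>i\<in>I. f i x)"
  using assms(2)
  by (induction I rule: infinite_finite_induct)
    (auto intro: smooth_fun_on_const smooth_fun_on_add assms(1))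

text \<open>On a set inside one chart domain, that chart alone decides smoothness: the other chart
  expressions arise by composition with a smooth transition map.\<close>

lemma smooth_fun_on_chart:
  assumes V: "(V, \<phi>) \<in> A" and W: "open W" "W \<subseteq> V" and f: "smooth_on (\<phi> ` W) (f \<circ> inv_into V \<phi>)"
  shows "smooth_fun_on A W f"
proof (rule smooth_fun_onI[OF W(1)])
  fix V' \<psi> assume V': "(V', \<psi>) \<in> A" and o: "open (\<psi> ` (W \<inter> V'))"
  let ?S = "\<psi> ` (W \<inter> V')"
  let ?t = "\<phi> \<circ> inv_into V' \<psi>"
  have "?S \<subseteq> \<psi> ` (V' \<inter> V)" using W(2) by auto
  then have t: "smooth_on ?S ?t" using chartD(4)[OF V' V] smooth_on_mono by blast
  have "?t ` ?S \<subseteq> \<phi> ` W" using chart_inv(1)[OF V'] by auto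
  from smooth_on_compose[OF coord_frame_frame o chart_open_image[OF V W] this t f]
  have "smooth_on ?S (\<lambda>x. (f \<circ> inv_into V \<phi>) (?t x))" .
  moreover have "(f \<circ> inv_into V \<phi>) (?t x) = (f \<circ> inv_into V' \<psi>) x" if "x \<in> ?S" for x
    using that chart_inv(1)[OF V] chart_inv(1)[OF V'] W(2) by auto
  ultimately show "smooth_on ?S (f \<circ> inv_into V' \<psi>)" 
    using smooth_on_cong[OF o, of "\<lambda>x. (f \<circ> inv_into V \<phi>) (?t x)" "f \<circ> inv_into V' \<psi>"] by simp
qed

lemma smooth_fun_on_chart_compose:
  assumes V: "(V, \<phi>) \<in> A" and S: "open S" "S \<subseteq> \<phi> ` V" and f: "smooth_on S f"
  shows "smooth_fun_on A (V \<inter> \<phi> -` S) (\<lambda>p. f (\<phi> p))"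
proof (rule smooth_fun_on_chart[OF V chart_open_vimage[OF V S(1)]])
  have eq: "\<phi> ` (V \<inter> \<phi> -` S) = S" using S(2) by auto
  have "f x = ((\<lambda>p. f (\<phi> p)) \<circ> inv_into V \<phi>) x" if "x \<in> S" for x
    using chart_inv(2)[OF V] that S(2) by auto
  then show "smooth_on (\<phi> ` (V \<inter> \<phi> -` S)) ((\<lambda>p. f (\<phi> p)) \<circ> inv_into V \<phi>)"
    unfolding eq using smooth_on_cong[OF S(1), of f "(\<lambda>p. f (\<phi> p)) \<circ> inv_into V \<phi>"] f by simp
qed simp

lemma smooth_fun_on_coord:
  assumes "(V, \<phi>) \<in> A"
  shows "smooth_fun_on A V (\<lambda>p. \<phi> p \<bullet> b)"
proof -
  have "V \<inter> \<phi> -` (\<phi> ` V) = V" by auto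
  then show ?thesis
    using smooth_fun_on_chart_compose[OF assms chartD(2)[OF assms] order_refl
        smooth_on_linear[OF bounded_linear_inner_left chartD(2)[OF assms]]] by simp
qed

section \<open>Global smooth functions and smooth germs\<close>

lemma smooth_functions_iff: "f \<in> smooth_functions A \<longleftrightarrow> smooth_fun_on A UNIV f"
  by (simp add: smooth_functions_def)

lemma smooth_functions_const: "(\<lambda>x. c) \<in> smooth_functions A"
  by (simp add: smooth_functions_iff smooth_fun_on_const)

lemma smooth_functions_on: "f \<in> smooth_functions A \<Longrightarrow> open U \<Longrightarrow> smooth_fun_on A U f"
  using smooth_fun_on_mono smooth_functions_iff by blast

lemma smooth_nearI: "smooth_fun_on A U f \<Longrightarrow> m \<in> U \<Longrightarrow> smooth_near A m f"
  unfolding smooth_near_def by blast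

lemma smooth_functions_near: "f \<in> smooth_functions A \<Longrightarrow> smooth_near A m f"
  using smooth_nearI smooth_functions_iff by blast

lemma smooth_near_combine:
  assumes "smooth_near A m f" "smooth_near A m g"
  obtains U where "m \<in> U" "smooth_fun_on A U f" "smooth_fun_on A U g"
proof -
  obtain U W where "m \<in> U" "smooth_fun_on A U f" "m \<in> W" "smooth_fun_on A W g"
    using assms unfolding smooth_near_def by blast
  then show ?thesis
    using that[of "U \<inter> W"] smooth_fun_on_mono[of U f "U \<inter> W"] smooth_fun_on_mono[of W g "U \<inter> W"]
      smooth_fun_onD(1) by blast
qed

lemma smooth_near_const: "smooth_near A m (\<lambda>x. c)"
  using smooth_nearI[OF smooth_fun_on_const[OF open_UNIV]] by blast

lemma smooth_near_add: "smooth_near A m f \<Longrightarrow> smooth_near A m g \<Longrightarrow> smooth_near A m (\<lambda>x. f x + g x)"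
  by (erule (1) smooth_near_combine) (auto intro: smooth_nearI smooth_fun_on_add)

lemma smooth_near_mult: "smooth_near A m f \<Longrightarrow> smooth_near A m g \<Longrightarrow> smooth_near A m (\<lambda>x. f x * g x)"
  by (erule (1) smooth_near_combine) (auto intro: smooth_nearI smooth_fun_on_mult)

lemma smooth_near_cmult: "smooth_near A m f \<Longrightarrow> smooth_near A m (\<lambda>x. c * f x)"
  by (intro smooth_near_mult smooth_near_const)

lemma smooth_near_sum:
  "(\<And>i. i \<in> I \<Longrightarrow> smooth_near A m (f i)) \<Longrightarrow> smooth_near A m (\<lambda>x. \<Sum>i\<in>I. f i x)"
  by (induction I rule: infinite_finite_induct) (auto intro: smooth_near_const smooth_near_add)

lemma smooth_near_cong:
  assumes "smooth_near A m f" "\<forall>\<^sub>F x in nhds m. f x = g x"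
  shows "smooth_near A m g"
proof -
  obtain U where U: "m \<in> U" "smooth_fun_on A U f" using assms(1) unfolding smooth_near_def by blast
  obtain W where W: "open W" "m \<in> W" "\<And>x. x \<in> W \<Longrightarrow> f x = g x"
    using assms(2) by (auto simp: eventually_nhds)
  have "smooth_fun_on A (U \<inter> W) f" using U W smooth_fun_onD(1) smooth_fun_on_mono by blast
  then have "smooth_fun_on A (U \<inter> W) g" using W(3) smooth_fun_on_cong by blast
  then show ?thesis using U W smooth_nearI by blast
qed

section \<open>Tangent vectors as derivations of germs\<close>

lemma tangentD:
  assumes "v \<in> tangent_space A m"
  shows "smooth_near A m f \<Longrightarrow> smooth_near A m g \<Longrightarrow> v (\<lambda>x. f x + g x) = v f + v g"
    "smooth_near A m f \<Longrightarrow> smooth_near A m g \<Longrightarrow> v (\<lambda>x. f x * g x) = f m * v g + g m * v f"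
    "smooth_near A m f \<Longrightarrow> v (\<lambda>x. c * f x) = c * v f"
    "smooth_near A m f \<Longrightarrow> \<forall>\<^sub>F x in nhds m. f x = g x \<Longrightarrow> v f = v g"
    "\<not> smooth_near A m f \<Longrightarrow> v f = 0"
  using assms smooth_near_cong unfolding tangent_space_def by blast+

lemma tangentI:
  assumes "\<And>f g. smooth_near A m f \<Longrightarrow> smooth_near A m g \<Longrightarrow> v (\<lambda>x. f x + g x) = v f + v g"
    "\<And>f g. smooth_near A m f \<Longrightarrow> smooth_near A m g \<Longrightarrow> v (\<lambda>x. f x * g x) = f m * v g + g m * v f"
    "\<And>c f. smooth_near A m f \<Longrightarrow> v (\<lambda>x. c * f x) = c * v f"
    "\<And>f g. smooth_near A m f \<Longrightarrow> smooth_near A m g \<Longrightarrow> \<forall>\<^sub>F x in nhds m. f x = g x \<Longrightarrow> v f = v g"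
    "\<And>f. \<not> smooth_near A m f \<Longrightarrow> v f = 0"
  shows "v \<in> tangent_space A m"
  using assms unfolding tangent_space_def by blast

lemma tangent_const:
  assumes "v \<in> tangent_space A m"
  shows "v (\<lambda>x. c) = 0"
proof -
  have "v (\<lambda>x. 1 * 1) = 1 * v (\<lambda>x. 1) + 1 * v (\<lambda>x. 1)"
    using tangentD(2)[OF assms smooth_near_const smooth_near_const, of 1 1] .
  then have "v (\<lambda>x. 1) = 0" by simp
  then show ?thesis using tangentD(3)[OF assms smooth_near_const, of c 1] by simp
qed

lemma tangent_sum:
  assumes "v \<in> tangent_space A m" "\<And>i. i \<in> I \<Longrightarrow> smooth_near A m (f i)"
  shows "v (\<lambda>x. \<Sum>i\<in>I. f i x) = (\<Sum>i\<in>I. v (f i))"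
  using assms(2)
  by (induction I rule: infinite_finite_induct)
    (auto simp: tangent_const[OF assms(1)] tangentD(1)[OF assms(1)] smooth_near_sum)

lemma tangent_lincomb:
  assumes "v \<in> tangent_space A m" "w \<in> tangent_space A m"
  shows "(\<lambda>f. a * v f + b * w f) \<in> tangent_space A m"
proof (rule tangentI)
  fix f g assume fg: "smooth_near A m f" "smooth_near A m g"
  show "a * v (\<lambda>x. f x + g x) + b * w (\<lambda>x. f x + g x) = a * v f + b * w f + (a * v g + b * w g)"
    using fg by (simp add: tangentD(1)[OF assms(1)] tangentD(1)[OF assms(2)] algebra_simps)
  show "a * v (\<lambda>x. f x * g x) + b * w (\<lambda>x. f x * g x) =
      f m * (a * v g + b * w g) + g m * (a * v f + b * w f)"
    using fg by (simp add: tangentD(2)[OF assms(1)] tangentD(2)[OF assms(2)] algebra_simps)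
  show "\<forall>\<^sub>F x in nhds m. f x = g x \<Longrightarrow> a * v f + b * w f = a * v g + b * w g"
    using fg tangentD(4)[OF assms(1) fg(1)] tangentD(4)[OF assms(2) fg(1)] by metis
next
  fix c f assume f: "smooth_near A m f"
  show "a * v (\<lambda>x. c * f x) + b * w (\<lambda>x. c * f x) = c * (a * v f + b * w f)"
    using f by (simp add: tangentD(3)[OF assms(1)] tangentD(3)[OF assms(2)] algebra_simps)
next
  fix f assume f: "\<not> smooth_near A m f"
  show "a * v f + b * w f = 0"
    using f by (simp add: tangentD(5)[OF assms(1)] tangentD(5)[OF assms(2)])
qed

section \<open>Vector fields as a module over the smooth functions\<close>

lemma vfD:
  assumes "X \<in> vector_fields A"
  shows "X m \<in> tangent_space A m" "smooth_fun_on A U f \<Longrightarrow> smooth_fun_on A U (\<lambda>m. X m f)"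
    "f \<in> smooth_functions A \<Longrightarrow> (\<lambda>m. X m f) \<in> smooth_functions A"
    "smooth_near A m f \<Longrightarrow> smooth_near A m (\<lambda>m. X m f)"
  using assms unfolding vector_fields_def smooth_functions_iff smooth_near_def by blast+

lemma vector_fieldsI:
  assumes "\<And>m. X m \<in> tangent_space A m" "\<And>U f. smooth_fun_on A U f \<Longrightarrow> smooth_fun_on A U (\<lambda>m. X m f)"
  shows "X \<in> vector_fields A"
  using assms unfolding vector_fields_def by blast

lemma vf_lincomb:
  assumes "X \<in> vector_fields A" "Y \<in> vector_fields A" "h \<in> smooth_functions A" "k \<in> smooth_functions A"
  shows "(\<lambda>m f. h m * X m f + k m * Y m f) \<in> vector_fields A"
proof (rule vector_fieldsI)
  show "(\<lambda>f. h m * X m f + k m * Y m f) \<in> tangent_space A m" for m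
    using tangent_lincomb vfD(1) assms(1,2) by blast
  show "smooth_fun_on A U (\<lambda>m. h m * X m f + k m * Y m f)" if "smooth_fun_on A U f" for U f
    using smooth_fun_onD(1)[OF that]
    by (intro smooth_fun_on_add smooth_fun_on_mult vfD(2)[OF assms(1) that] vfD(2)[OF assms(2) that]
        smooth_functions_on[OF assms(3)] smooth_functions_on[OF assms(4)])
qed

lemma vf_add_closed: "X \<in> vector_fields A \<Longrightarrow> Y \<in> vector_fields A \<Longrightarrow> vf_add X Y \<in> vector_fields A"
  using vf_lincomb[OF _ _ smooth_functions_const[of 1] smooth_functions_const[of 1]]
  by (simp add: vf_add_def)

lemma vf_scale_closed: "h \<in> smooth_functions A \<Longrightarrow> X \<in> vector_fields A \<Longrightarrow> vf_scale h X \<in> vector_fields A"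
  using vf_lincomb[OF _ _ _ smooth_functions_const[of 0], of X X h]
  by (simp add: vf_scale_def)

lemma vf_zero_closed: "(\<lambda>m f. 0) \<in> vector_fields A"
proof (rule vector_fieldsI)
  show "(\<lambda>f. 0) \<in> tangent_space A m" for m by (rule tangentI) auto
  show "smooth_fun_on A U (\<lambda>m. 0)" if "smooth_fun_on A U f" for U f
    using smooth_fun_on_const smooth_fun_onD(1)[OF that] by blast
qed

subsection \<open>Cut-off functions and coordinate fields\<close>

text \<open>In the chart, take the flat function of r^2 minus the squared distance to the image of
  m, divided by its value at m, and extend by zero. The result is smooth on \<open>V\<close> by the
  formula and on \<open>- K\<close> because it vanishes there; these two sets cover the
  manifold.\<close>

lemma ex_cutoff:
  assumes V: "(V, \<phi>) \<in> A" and m: "m \<in> V"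
  obtains \<rho> K where "\<rho> \<in> smooth_functions A" "\<rho> m = 1" "closed K" "K \<subseteq> V" "\<And>p. p \<notin> K \<Longrightarrow> \<rho> p = 0"
proof -
  obtain r where r: "r > 0" "cball (\<phi> m) r \<subseteq> \<phi> ` V"
    using chartD(2)[OF V] m open_contains_cball by blast
  define K where "K = inv_into V \<phi> ` cball (\<phi> m) r"
  have "compact K" unfolding K_def
    by (intro compact_continuous_image compact_cball_coord_frame[OF coord_frame_frame]
        continuous_on_subset[OF chart_continuous(2)[OF V] r(2)])
  \<comment> \<open>This is where the Hausdorff property enters: \<open>K\<close> is compact, and
    closedness in the whole manifold makes \<open>- K\<close> open.\<close>
  then have clK: "closed K" by (rule compact_imp_closed)
  have KV: "K \<subseteq> V" using chart_inv(3)[OF V] r(2) by (auto simp: K_def)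
  let ?q = "\<lambda>x. r\<^sup>2 - (x - \<phi> m) \<bullet> (x - \<phi> m)"
  define \<rho> where "\<rho> p = (if p \<in> V then flat_exp 0 (?q (\<phi> p)) * (1 / flat_exp 0 (r\<^sup>2)) else 0)" for p
  have pos: "flat_exp 0 (r\<^sup>2) > 0" using r(1) by (simp add: flat_exp_def)
  have 0: "\<rho> p = 0" if "p \<notin> K" for p
  proof (cases "p \<in> V")
    case True
    then have "\<phi> p \<notin> cball (\<phi> m) r" using that chart_inv(1)[OF V True] by (force simp: K_def)
    then have "r < norm (\<phi> p - \<phi> m)" by (simp add: dist_norm norm_minus_commute)
    then have "r\<^sup>2 < (norm (\<phi> p - \<phi> m))\<^sup>2" using r(1) by (intro power_strict_mono) auto
    then show ?thesis by (simp add: \<rho>_def flat_exp_def power2_norm_eq_inner)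
  qed (simp add: \<rho>_def)
  have "smooth_on (\<phi> ` V) (\<lambda>x. flat_exp 0 (?q x) * (1 / flat_exp 0 (r\<^sup>2)))"
  proof (intro smooth_on_mult smooth_on_const chartD(2)[OF V])
    have d: "smooth_on (\<phi> ` V) (\<lambda>x. x - \<phi> m)"
      using smooth_on_add[OF chartD(2)[OF V] smooth_on_linear[OF bounded_linear_ident chartD(2)[OF V]] smooth_on_const, of "- \<phi> m"]
      by simp
    have "smooth_on (\<phi> ` V) (\<lambda>x. r\<^sup>2 + (-1) * ((x - \<phi> m) \<bullet> (x - \<phi> m)))"
      by (intro smooth_on_add smooth_on_const smooth_on_mult smooth_on_bilinear[OF bounded_bilinear_inner] d chartD(2)[OF V])
    then have "smooth_on (\<phi> ` V) ?q" by simp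
    from smooth_on_compose[OF coord_frame_real chartD(2)[OF V] open_UNIV subset_UNIV this smooth_on_flat_exp]
    show "smooth_on (\<phi> ` V) (\<lambda>x. flat_exp 0 (?q x))" .
  qed
  from smooth_fun_on_chart_compose[OF V chartD(2)[OF V] order_refl this]
  have "smooth_fun_on A (V \<inter> \<phi> -` \<phi> ` V) (\<lambda>p. flat_exp 0 (?q (\<phi> p)) * (1 / flat_exp 0 (r\<^sup>2)))" .
  moreover have "V \<inter> \<phi> -` \<phi> ` V = V" by auto
  ultimately have 1: "smooth_fun_on A V \<rho>"
    using smooth_fun_on_cong[of V _ \<rho>] by (simp add: \<rho>_def)
  have "smooth_fun_on A (- K) (\<lambda>p. 0)" using clK smooth_fun_on_const by blast
  then have 2: "smooth_fun_on A (- K) \<rho>" by (rule smooth_fun_on_cong) (simp add: 0)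
  have "smooth_fun_on A UNIV \<rho>"
  proof (rule smooth_fun_on_local)
    show "\<exists>W. p \<in> W \<and> W \<subseteq> UNIV \<and> smooth_fun_on A W \<rho>" for p
      using 1 2 KV by (cases "p \<in> K") (auto intro: exI[of _ V] exI[of _ "- K"])
  qed
  moreover have "\<rho> m = 1" using m pos by (simp add: \<rho>_def)
  ultimately show ?thesis using that[of \<rho> K] clK KV 0 by (simp add: smooth_functions_iff)
qed

text \<open>Extension by zero: the values of \<open>f\<close> outside \<open>V\<close> are
  arbitrary, but \<open>\<rho>\<close> annihilates them, so \<open>U\<close> is covered by
  \<open>U \<inter> V\<close> and \<open>U - K\<close>.\<close>

lemma smooth_fun_on_cutoff:
  assumes \<rho>: "\<rho> \<in> smooth_functions A" "closed K" "K \<subseteq> V" "\<And>p. p \<notin> K \<Longrightarrow> \<rho> p = 0"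
    and U: "open U" and f: "smooth_fun_on A (U \<inter> V) f"
  shows "smooth_fun_on A U (\<lambda>p. \<rho> p * f p)"
proof (rule smooth_fun_on_local)
  have 1: "smooth_fun_on A (U \<inter> V) (\<lambda>p. \<rho> p * f p)"
    by (intro smooth_fun_on_mult f smooth_functions_on \<rho>(1) smooth_fun_onD(1)[OF f])
  have "smooth_fun_on A (U - K) (\<lambda>p. 0)" using U \<rho>(2) by (intro smooth_fun_on_const open_Diff)
  then have 2: "smooth_fun_on A (U - K) (\<lambda>p. \<rho> p * f p)" by (rule smooth_fun_on_cong) (simp add: \<rho>(4))
  fix p assume p: "p \<in> U"
  show "\<exists>W. p \<in> W \<and> W \<subseteq> U \<and> smooth_fun_on A W (\<lambda>p. \<rho> p * f p)"
  proof (cases "p \<in> K")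
    case True
    then show ?thesis using p 1 \<rho>(3) by (intro exI[of _ "U \<inter> V"]) auto
  next
    case False
    then show ?thesis using p 2 by (intro exI[of _ "U - K"]) auto
  qed
qed

text \<open>The partial derivative in direction b of a chart, cut off by \<open>\<rho>\<close> to
  become global. The case distinction implements the convention that tangent vectors are zero on
  functions not smooth near the point; outside the chart domain a vanishing \<open>\<rho>\<close>
  hides the meaningless derivative.\<close>

definition coord_field :: "'a set \<Rightarrow> ('a \<Rightarrow> 'e) \<Rightarrow> ('a \<Rightarrow> real) \<Rightarrow> 'e \<Rightarrow> 'a vfield" where
  "coord_field V \<phi> \<rho> b p f =
     (if smooth_near A p f then \<rho> p * frechet_derivative (f \<circ> inv_into V \<phi>) (at (\<phi> p)) b else 0)"

lemma chart_has_derivative: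
  assumes V: "(V, \<phi>) \<in> A" and p: "p \<in> V" and f: "smooth_near A p f"
  shows "((f \<circ> inv_into V \<phi>) has_derivative frechet_derivative (f \<circ> inv_into V \<phi>) (at (\<phi> p))) (at (\<phi> p))"
proof -
  obtain U where U: "p \<in> U" "smooth_fun_on A U f" using f unfolding smooth_near_def by blast
  show ?thesis
    using smooth_on_has_derivative[OF smooth_fun_onD(2)[OF U(2) V], of "\<phi> p"] U(1) p by blast
qed

lemma coord_derivative_tangent:
  assumes V: "(V, \<phi>) \<in> A" and p: "p \<in> V"
  shows "(\<lambda>f. if smooth_near A p f then frechet_derivative (f \<circ> inv_into V \<phi>) (at (\<phi> p)) b else 0)
    \<in> tangent_space A p"
    (is "?v \<in> _")
proof -
  let ?i = "inv_into V \<phi>"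
  note D = chart_has_derivative[OF V p]
  note near = smooth_near_add smooth_near_mult smooth_near_cmult
  show ?thesis
  proof (rule tangentI)
    fix f g assume f: "smooth_near A p f" and g: "smooth_near A p g"
    have "(((\<lambda>x. f x + g x) \<circ> ?i) has_derivative
        (\<lambda>v. frechet_derivative (f \<circ> ?i) (at (\<phi> p)) v + frechet_derivative (g \<circ> ?i) (at (\<phi> p)) v)) (at (\<phi> p))"
      using has_derivative_add[OF D[OF f] D[OF g]] by (simp add: o_def)
    then show "?v (\<lambda>x. f x + g x) = ?v f + ?v g"
      using f g near by (simp add: frechet_derivative_eq)
    have "(((\<lambda>x. f x * g x) \<circ> ?i) has_derivative
        (\<lambda>v. f p * frechet_derivative (g \<circ> ?i) (at (\<phi> p)) v + frechet_derivative (f \<circ> ?i) (at (\<phi> p)) v * g p)) (at (\<phi> p))"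
      using has_derivative_mult[OF D[OF f] D[OF g]] chart_inv(1)[OF V p] by (simp add: o_def)
    then show "?v (\<lambda>x. f x * g x) = f p * ?v g + g p * ?v f"
      using f g near by (simp add: frechet_derivative_eq)
    assume "\<forall>\<^sub>F x in nhds p. f x = g x"
    then obtain W where W: "open W" "p \<in> W" "\<And>x. x \<in> W \<Longrightarrow> f x = g x" by (auto simp: eventually_nhds)
    have "open (\<phi> ` (V \<inter> W))" using chart_open_image[OF V] W(1) chartD(1)[OF V] by blast
    moreover have "\<phi> p \<in> \<phi> ` (V \<inter> W)" using p W by blast
    moreover have "(f \<circ> ?i) x = (g \<circ> ?i) x" if "x \<in> \<phi> ` (V \<inter> W)" for x
      using that W(3) chart_inv(1)[OF V] by auto
    ultimately have "frechet_derivative (f \<circ> ?i) (at (\<phi> p)) = frechet_derivative (g \<circ> ?i) (at (\<phi> p))"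
      by (rule frechet_derivative_cong_open(3))
    then show "?v f = ?v g" using f g by simp
  next
    fix c f assume f: "smooth_near A p f"
    have "(((\<lambda>x. c * f x) \<circ> ?i) has_derivative (\<lambda>v. c * frechet_derivative (f \<circ> ?i) (at (\<phi> p)) v)) (at (\<phi> p))"
      using has_derivative_mult_right[OF D[OF f]] by (simp add: o_def)
    then show "?v (\<lambda>x. c * f x) = c * ?v f"
      using f near by (simp add: frechet_derivative_eq)
  qed simp
qed

lemma coord_field_closed:
  assumes V: "(V, \<phi>) \<in> A"
    and \<rho>: "\<rho> \<in> smooth_functions A" "closed K" "K \<subseteq> V" "\<And>p. p \<notin> K \<Longrightarrow> \<rho> p = 0"
  shows "coord_field V \<phi> \<rho> b \<in> vector_fields A"
proof (rule vector_fieldsI)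
  show "coord_field V \<phi> \<rho> b p \<in> tangent_space A p" for p
  proof (cases "p \<in> V")
    case True
    from tangent_lincomb[OF coord_derivative_tangent[OF V True] vfD(1)[OF vf_zero_closed], of "\<rho> p" b 0]
    moreover have "coord_field V \<phi> \<rho> b p = (\<lambda>f. \<rho> p * (if smooth_near A p f
        then frechet_derivative (f \<circ> inv_into V \<phi>) (at (\<phi> p)) b else 0) + 0 * 0)"
      by (auto simp: coord_field_def)
    ultimately show ?thesis by simp
  next
    case False
    then have "coord_field V \<phi> \<rho> b p = (\<lambda>f. 0)" using \<rho>(3,4) by (auto simp: coord_field_def fun_eq_iff)
    then show ?thesis using vfD(1)[OF vf_zero_closed] by simp
  qed
  fix U f assume f: "smooth_fun_on A U f"
  let ?d = "\<lambda>p. frechet_derivative (f \<circ> inv_into V \<phi>) (at (\<phi> p)) b"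
  have oUV: "open (U \<inter> V)" using smooth_fun_onD(1)[OF f] chartD(1)[OF V] by blast
  have "V \<inter> \<phi> -` (\<phi> ` (U \<inter> V)) = U \<inter> V" using chart_inv(1)[OF V] by auto metis
  then have "smooth_fun_on A (U \<inter> V) ?d"
    using smooth_fun_on_chart_compose[OF V chart_open_image[OF V oUV] _
        smooth_on_frechet_derivative[OF smooth_fun_onD(2)[OF f V]]] by (simp add: image_mono)
  from smooth_fun_on_cutoff[OF \<rho> smooth_fun_onD(1)[OF f] this]
  show "smooth_fun_on A U (\<lambda>p. coord_field V \<phi> \<rho> b p f)"
  proof (rule smooth_fun_on_cong)
    fix p assume "p \<in> U"
    with f have "smooth_near A p f" by (rule smooth_nearI)
    then show "\<rho> p * ?d p = coord_field V \<phi> \<rho> b p f" by (simp add: coord_field_def)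
  qed
qed

text \<open>Apply the derivation to the Hadamard expansion of f in the chart. The constant is
  killed, and in each product the factor that vanishes at p leaves only the derivative of the
  coordinate times the value of \<open>g b\<close>, which is a partial derivative of f.\<close>

lemma tangent_coords:
  assumes V: "(V, \<phi>) \<in> A" and p: "p \<in> V" and v: "v \<in> tangent_space A p" and f: "smooth_near A p f"
  shows "v f = (\<Sum>b\<in>frame. v (\<lambda>q. \<phi> q \<bullet> b) * frechet_derivative (f \<circ> inv_into V \<phi>) (at (\<phi> p)) b)"
proof -
  obtain U where U: "p \<in> U" "smooth_fun_on A U f" using f unfolding smooth_near_def by blast
  let ?i = "inv_into V \<phi>"
  let ?F = "f \<circ> ?i" and ?a = "\<phi> p"
  have "open (\<phi> ` (U \<inter> V))" using chart_open_image[OF V] chartD(1)[OF V] smooth_fun_onD(1)[OF U(2)] by blast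
  then obtain r where r: "r > 0" "ball ?a r \<subseteq> \<phi> ` (U \<inter> V)"
    using U(1) p open_contains_ball by blast
  obtain g where g: "\<And>b. smooth_on (ball ?a r) (g b)" "\<And>b. g b ?a = frechet_derivative ?F (at ?a) b"
    "\<And>x. x \<in> ball ?a r \<Longrightarrow> ?F x = ?F ?a + (\<Sum>b\<in>frame. ((x - ?a) \<bullet> b) * g b x)"
    using smooth_on_hadamard[OF coord_frame_frame smooth_on_mono[OF smooth_fun_onD(2)[OF U(2) V] r(2)] r(1)]
    by blast
  define N where "N = V \<inter> \<phi> -` ball ?a r"
  have N: "open N" "p \<in> N" using chart_open_vimage[OF V] p r(1) by (auto simp: N_def)
  have sg: "smooth_near A p (\<lambda>q. g b (\<phi> q))" for b
    using smooth_fun_on_chart_compose[OF V open_ball _ g(1)[of b]] r(2) N(2)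
    by (intro smooth_nearI[of N]) (auto simp: N_def)
  have sx: "smooth_near A p (\<lambda>q. \<phi> q \<bullet> b)" for b
    using smooth_nearI[OF smooth_fun_on_coord[OF V] p] .
  have sx': "smooth_near A p (\<lambda>q. \<phi> q \<bullet> b + - (?a \<bullet> b))" for b
    by (intro smooth_near_add sx smooth_near_const)
  have ev: "\<forall>\<^sub>F q in nhds p. f q = f p + (\<Sum>b\<in>frame. (\<phi> q \<bullet> b + - (?a \<bullet> b)) * g b (\<phi> q))"
  proof (rule eventually_mono[OF eventually_nhds_in_open[OF N]])
    fix q assume "q \<in> N"
    then show "f q = f p + (\<Sum>b\<in>frame. (\<phi> q \<bullet> b + - (?a \<bullet> b)) * g b (\<phi> q))"
      using g(3)[of "\<phi> q"] chart_inv(1)[OF V] p by (simp add: N_def inner_diff_left)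
  qed
  have "v f = v (\<lambda>q. f p + (\<Sum>b\<in>frame. (\<phi> q \<bullet> b + - (?a \<bullet> b)) * g b (\<phi> q)))"
    using tangentD(4)[OF v f ev] .
  also have "\<dots> = (\<Sum>b\<in>frame. v (\<lambda>q. (\<phi> q \<bullet> b + - (?a \<bullet> b)) * g b (\<phi> q)))"
    using sg sx' by (simp add: tangentD(1)[OF v] smooth_near_const smooth_near_sum smooth_near_mult
        tangent_const[OF v] tangent_sum[OF v])
  also have "\<dots> = (\<Sum>b\<in>frame. v (\<lambda>q. \<phi> q \<bullet> b) * frechet_derivative ?F (at ?a) b)"
  proof (rule sum.cong[OF refl])
    fix b
    have "v (\<lambda>q. \<phi> q \<bullet> b + - (?a \<bullet> b)) = v (\<lambda>q. \<phi> q \<bullet> b)"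
      using tangentD(1)[OF v sx smooth_near_const, of b "- (?a \<bullet> b)"] tangent_const[OF v, of "- (?a \<bullet> b)"] by linarith
    moreover have "v (\<lambda>q. (\<phi> q \<bullet> b + - (?a \<bullet> b)) * g b (\<phi> q)) =
        (?a \<bullet> b + - (?a \<bullet> b)) * v (\<lambda>q. g b (\<phi> q)) + g b ?a * v (\<lambda>q. \<phi> q \<bullet> b + - (?a \<bullet> b))"
      by (rule tangentD(2)[OF v sx' sg])
    ultimately show "v (\<lambda>q. (\<phi> q \<bullet> b + - (?a \<bullet> b)) * g b (\<phi> q)) =
        v (\<lambda>q. \<phi> q \<bullet> b) * frechet_derivative ?F (at ?a) b"
      using g(2) by simp
  qed
  finally show ?thesis .
qed

section \<open>Extension of tangent vectors and tensoriality\<close>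

lemma vf_comb_closed:
  assumes "finite I" "\<And>i. i \<in> I \<Longrightarrow> h i \<in> smooth_functions A" "\<And>i. i \<in> I \<Longrightarrow> Z i \<in> vector_fields A"
  shows "(\<lambda>p f. \<Sum>i\<in>I. h i p * Z i p f) \<in> vector_fields A"
  using assms
proof (induction I)
  case (insert i I)
  from vf_lincomb[OF insert.prems(2) insert.IH, of i "h i" "\<lambda>_. 1"] insert
  show ?case by (simp add: smooth_functions_const)
qed (simp add: vf_zero_closed)

text \<open>The chart components of v are frozen as constants; since the cut-off is 1 at m, the
  resulting combination of coordinate fields still has the value v there.\<close>

lemma ex_vector_field:
  assumes v: "v \<in> tangent_space A m"
  obtains X where "X \<in> vector_fields A" "X m = v"
proof -
  obtain V \<phi> where V: "(V, \<phi>) \<in> A" and m: "m \<in> V" using chart_cover .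
  obtain \<rho> K where \<rho>: "\<rho> \<in> smooth_functions A" "closed K" "K \<subseteq> V" "\<And>p. p \<notin> K \<Longrightarrow> \<rho> p = 0" and 1: "\<rho> m = 1"
    using ex_cutoff[OF V m] by metis
  let ?X = "\<lambda>p f. \<Sum>b\<in>frame. v (\<lambda>q. \<phi> q \<bullet> b) * coord_field V \<phi> \<rho> b p f"
  have "?X \<in> vector_fields A"
    by (intro vf_comb_closed[of frame "\<lambda>b _. v (\<lambda>q. \<phi> q \<bullet> b)"] finite_frame smooth_functions_const coord_field_closed[OF V \<rho>])
  moreover have "?X m = v"
  proof
    fix f show "?X m f = v f"
    proof (cases "smooth_near A m f")
      case True
      then show ?thesis using tangent_coords[OF V m v True] by (simp add: coord_field_def 1)
    next
      case False
      then show ?thesis using tangentD(5)[OF v] by (simp add: coord_field_def)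
    qed
  qed
  ultimately show ?thesis using that by blast
qed

text \<open>The components of Y and the coordinate fields are both local, so each takes one factor
  \<open>\<rho>\<close> to become global. This yields a decomposition of \<open>\<rho>\<close>
  squared times Y; the rest of Y has the coefficient 1 - \<open>\<rho>\<close> squared, which also
  vanishes at m.\<close>

lemma vector_field_zero_decomp:
  assumes Y: "Y \<in> vector_fields A" and Y0: "Y m = (\<lambda>f. 0)"
  shows "\<exists>h Z h\<^sub>0. (\<forall>b. h b \<in> smooth_functions A \<and> h b m = 0 \<and> Z b \<in> vector_fields A) \<and>
    h\<^sub>0 \<in> smooth_functions A \<and> h\<^sub>0 m = 0 \<and>
    Y = vf_add (vf_scale h\<^sub>0 Y) (\<lambda>p f. \<Sum>b\<in>frame. h b p * Z b p f)"
proof -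
  obtain V \<phi> where V: "(V, \<phi>) \<in> A" and m: "m \<in> V" using chart_cover .
  obtain \<rho> K where \<rho>: "\<rho> \<in> smooth_functions A" "closed K" "K \<subseteq> V" "\<And>p. p \<notin> K \<Longrightarrow> \<rho> p = 0" and 1: "\<rho> m = 1"
    using ex_cutoff[OF V m] by metis
  define h where "h b p = \<rho> p * Y p (\<lambda>q. \<phi> q \<bullet> b)" for b p
  define Z where "Z = coord_field V \<phi> \<rho>"
  define h\<^sub>0 where "h\<^sub>0 p = 1 - \<rho> p * \<rho> p" for p
  have "h b \<in> smooth_functions A" for b
    unfolding smooth_functions_iff h_def
    using smooth_fun_on_cutoff[OF \<rho> open_UNIV] vfD(2)[OF Y smooth_fun_on_coord[OF V]] by simp
  moreover have "h b m = 0" for b by (simp add: h_def Y0)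
  moreover have "Z b \<in> vector_fields A" for b unfolding Z_def by (rule coord_field_closed[OF V \<rho>])
  moreover have "h\<^sub>0 \<in> smooth_functions A"
    using \<rho>(1) unfolding smooth_functions_iff h\<^sub>0_def
    by (intro smooth_fun_on_diff smooth_fun_on_mult smooth_fun_on_const open_UNIV)
  moreover have "h\<^sub>0 m = 0" by (simp add: h\<^sub>0_def 1)
  moreover have "Y = vf_add (vf_scale h\<^sub>0 Y) (\<lambda>p f. \<Sum>b\<in>frame. h b p * Z b p f)"
  proof (intro ext)
    fix p f
    have "\<rho> p * \<rho> p * Y p f = (\<Sum>b\<in>frame. h b p * Z b p f)"
    proof (cases "p \<in> V \<and> smooth_near A p f")
      case True
      then show ?thesis
        using tangent_coords[OF V _ vfD(1)[OF Y], of p f]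
        by (simp add: Z_def coord_field_def h_def sum_distrib_left mult_ac)
    next
      case False
      \<comment> \<open>Either f is not smooth near p and both sides vanish by convention, or p lies
        outside \<open>V\<close>, where the cut-off is zero.\<close>
      then have "\<not> smooth_near A p f \<and> Y p f = 0 \<or> \<rho> p = 0"
        using tangentD(5)[OF vfD(1)[OF Y], of p f] \<rho>(3) \<rho>(4)[of p] by blast
      then show ?thesis by (auto simp: Z_def coord_field_def h_def)
    qed
    then show "Y p f = vf_add (vf_scale h\<^sub>0 Y) (\<lambda>p f. \<Sum>b\<in>frame. h b p * Z b p f) p f"
      by (simp add: vf_add_def vf_scale_def h\<^sub>0_def algebra_simps)
  qed
  ultimately show ?thesis by (intro exI[of _ h] exI[of _ Z] exI[of _ h\<^sub>0]) blast
qed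

text \<open>
  A map on vector fields that is linear over the smooth functions is tensorial: at \<open>m\<close> it only
  depends on the value of the field at \<open>m\<close>, as a field vanishing at \<open>m\<close> is a combination of fields
  with coefficients vanishing at \<open>m\<close>.
\<close>

lemma tensorial:
  fixes T :: "'a vfield \<Rightarrow> real"
  assumes add: "\<And>X Y. X \<in> vector_fields A \<Longrightarrow> Y \<in> vector_fields A \<Longrightarrow> T (vf_add X Y) = T X + T Y"
    and scale: "\<And>h X. h \<in> smooth_functions A \<Longrightarrow> X \<in> vector_fields A \<Longrightarrow> T (vf_scale h X) = h m * T X"
    and X: "X \<in> vector_fields A" and Y: "Y \<in> vector_fields A" and eq: "X m = Y m"
  shows "T X = T Y"
proof -
  define W where "W = vf_add X (vf_scale (\<lambda>_. -1) Y)"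
  have W: "W \<in> vector_fields A"
    unfolding W_def by (intro vf_add_closed vf_scale_closed smooth_functions_const X Y)
  have "W m = (\<lambda>f. 0)" using eq by (simp add: W_def vf_add_def vf_scale_def)
  then obtain h Z h\<^sub>0 where h: "\<And>b. h b \<in> smooth_functions A" "\<And>b. h b m = 0" and Z: "\<And>b. Z b \<in> vector_fields A"
    and h0: "h\<^sub>0 \<in> smooth_functions A" "h\<^sub>0 m = 0"
    and dec: "W = vf_add (vf_scale h\<^sub>0 W) (\<lambda>p f. \<Sum>b\<in>frame. h b p * Z b p f)"
    using vector_field_zero_decomp[OF W] by blast
  have T0: "T (\<lambda>p f. 0) = 0"
    using scale[OF smooth_functions_const[of 0] W] by (simp add: vf_scale_def)
  have "T (\<lambda>p f. \<Sum>b\<in>C. h b p * Z b p f) = 0" if "finite C" for C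
    using that
  proof (induction C)
    case (insert b C)
    have "(\<lambda>p f. \<Sum>b\<in>insert b C. h b p * Z b p f) =
        vf_add (vf_scale (h b) (Z b)) (\<lambda>p f. \<Sum>b\<in>C. h b p * Z b p f)"
      using insert by (simp add: vf_add_def vf_scale_def)
    then show ?case
      using insert add[OF vf_scale_closed[OF h(1) Z] vf_comb_closed[OF insert.hyps(1) h(1) Z]] scale[OF h(1) Z] h(2)
      by simp
  qed (simp add: T0)
  \<comment> \<open>\<open>W\<close> occurs on both sides of \<open>dec\<close>. This is harmless:
    its coefficient on the right vanishes at m, so the right side evaluates to 0 without knowledge
    of \<open>T W\<close>.\<close>
  then have "T (vf_add (vf_scale h\<^sub>0 W) (\<lambda>p f. \<Sum>b\<in>frame. h b p * Z b p f)) = 0"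
    using add[OF vf_scale_closed[OF h0(1) W] vf_comb_closed[OF finite_frame h(1) Z]] scale[OF h0(1) W] h0(2)
      finite_frame by simp
  then have "T W = 0" using dec by simp
  then show ?thesis
    unfolding W_def
    using add[OF X vf_scale_closed[OF smooth_functions_const[of "-1"] Y]] scale[OF smooth_functions_const[of "-1"] Y]
    by simp
qed

end

section \<open>Functions vanishing to a given order\<close>

text \<open>An inductive counterpart of the powers of the ideal of germs vanishing at m. Products
  are built one factor at a time, so that the effect of a derivation can be proved by rule induction
  instead of by manipulating double-indexed sums of products. Order 0 means merely smooth near
  m.\<close>

inductive vanishes_to :: "('a::t2_space, 'e::real_inner) chart set \<Rightarrow> 'a \<Rightarrow> nat \<Rightarrow> ('a \<Rightarrow> real) \<Rightarrow> bool"
  for A m where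
  smooth: "smooth_near A m f \<Longrightarrow> vanishes_to A m 0 f"
| zero: "vanishes_to A m n (\<lambda>x. 0)"
| mult: "a \<in> vanishing_at A m \<Longrightarrow> vanishes_to A m n f \<Longrightarrow> vanishes_to A m (Suc n) (\<lambda>x. a x * f x)"
| add: "vanishes_to A m n f \<Longrightarrow> vanishes_to A m n g \<Longrightarrow> vanishes_to A m n (\<lambda>x. f x + g x)"
| cong: "vanishes_to A m n f \<Longrightarrow> \<forall>\<^sub>F x in nhds m. f x = g x \<Longrightarrow> vanishes_to A m n g"

context smooth_mfd
begin

text \<open>The rules for derivations at a point p need smoothness near p itself; this provides it
  for all p close to m.\<close>

lemma smooth_near_eventually: "smooth_near A m f \<Longrightarrow> \<forall>\<^sub>F p in nhds m. smooth_near A p f"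
  unfolding smooth_near_def eventually_nhds using smooth_fun_onD(1) by blast

lemma vanishes_to_near: "vanishes_to A m n f \<Longrightarrow> smooth_near A m f"
  by (induction rule: vanishes_to.induct)
    (auto intro: smooth_near_const smooth_near_add smooth_near_mult smooth_near_cong simp: vanishing_at_def)

text \<open>Ideal property: the smooth multiplier is passed down to the order-zero factor at the
  bottom of each product.\<close>

lemma vanishes_to_smooth_mult:
  assumes "vanishes_to A m n f" "smooth_near A m a"
  shows "vanishes_to A m n (\<lambda>x. a x * f x)"
  using assms(1)
proof (induction rule: vanishes_to.induct)
  case (smooth f)
  then show ?case using assms(2) by (intro vanishes_to.smooth smooth_near_mult)
next
  case (zero n)
  then show ?case by (simp add: vanishes_to.zero)
next
  case (mult b n f)
  from vanishes_to.mult[OF mult.hyps(1) mult.IH] show ?case by (simp add: mult_ac)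
next
  case (add n f g)
  from vanishes_to.add[OF add.IH] show ?case by (simp add: distrib_left)
next
  case (cong n f g)
  show ?case by (rule vanishes_to.cong[OF cong.IH]) (use cong.hyps(2) in eventually_elim, simp)
qed

lemma vanishes_to_diff:
  "vanishes_to A m n f \<Longrightarrow> vanishes_to A m n g \<Longrightarrow> vanishes_to A m n (\<lambda>x. f x - g x)"
  using vanishes_to.add[of A m n f "\<lambda>x. -1 * g x"] vanishes_to_smooth_mult[OF _ smooth_near_const, of m n g "-1"]
  by simp

lemma vanishes_to_sum:
  "(\<And>i. i \<in> I \<Longrightarrow> vanishes_to A m n (f i)) \<Longrightarrow> vanishes_to A m n (\<lambda>x. \<Sum>i\<in>I. f i x)"
  by (induction I rule: infinite_finite_induct) (auto intro: vanishes_to.zero vanishes_to.add)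

text \<open>To give up one order, regard one vanishing factor as a mere smooth multiplier.\<close>

lemma vanishes_to_pred: "vanishes_to A m n f \<Longrightarrow> vanishes_to A m (n - 1) f"
proof (induction rule: vanishes_to.induct)
  case (mult a n f)
  then show ?case using vanishes_to_smooth_mult by (simp add: vanishing_at_def)
qed (auto intro: vanishes_to.intros)

lemma vanishes_to_eq_0: "vanishes_to A m n f \<Longrightarrow> n > 0 \<Longrightarrow> f m = 0"
  by (induction rule: vanishes_to.induct)
    (auto simp: vanishing_at_def dest: eventually_nhds_x_imp_x)

text \<open>By the Leibniz rule a product \<open>a * f\<close> becomes a sum of two terms. In one,
  the factor a makes up for the order lost by f; in the other, f is left undifferentiated and keeps
  its order.\<close>

lemma vanishes_to_derivation:
  assumes X: "X \<in> vector_fields A" and "vanishes_to A m n f"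
  shows "vanishes_to A m (n - 1) (\<lambda>p. X p f)"
  using assms(2)
proof (induction rule: vanishes_to.induct)
  case (smooth f)
  then show ?case using vfD(4)[OF X] by (simp add: vanishes_to.smooth)
next
  case (zero n)
  then show ?case using tangent_const[OF vfD(1)[OF X]] by (simp add: vanishes_to.zero)
next
  case (mult a n f)
  have a: "smooth_near A m a" using mult.hyps(1) by (simp add: vanishing_at_def)
  have f: "smooth_near A m f" using vanishes_to_near[OF mult.hyps(2)] .
  have "vanishes_to A m n (\<lambda>p. a p * X p f)"
  \<comment> \<open>For n = 0 the truncated \<open>n - 1\<close> is again 0, and
    \<open>vanishes_to.mult\<close> would yield order 1 where order 0 is wanted; smoothness is
    enough there.\<close>
  proof (cases n)
    case 0
    then show ?thesis using vfD(4)[OF X f] a by (auto intro: vanishes_to.smooth smooth_near_mult)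
  next
    case (Suc k)
    then show ?thesis using vanishes_to.mult[OF mult.hyps(1) mult.IH] by simp
  qed
  from vanishes_to.add[OF this vanishes_to_smooth_mult[OF mult.hyps(2) vfD(4)[OF X a]]]
  have "vanishes_to A m n (\<lambda>p. a p * X p f + X p a * f p)" .
  moreover have "\<forall>\<^sub>F p in nhds m. a p * X p f + X p a * f p = X p (\<lambda>x. a x * f x)"
    using smooth_near_eventually[OF a] smooth_near_eventually[OF f]
    by eventually_elim (simp add: tangentD(2)[OF vfD(1)[OF X]] mult.commute)
  ultimately show ?case using vanishes_to.cong by simp
next
  case (add n f g)
  have "\<forall>\<^sub>F p in nhds m. X p f + X p g = X p (\<lambda>x. f x + g x)"
    using smooth_near_eventually[OF vanishes_to_near[OF add.hyps(1)]]
      smooth_near_eventually[OF vanishes_to_near[OF add.hyps(2)]]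
    by eventually_elim (simp add: tangentD(1)[OF vfD(1)[OF X]])
  then show ?case by (rule vanishes_to.cong[OF vanishes_to.add[OF add.IH]])
next
  case (cong n f g)
  \<comment> \<open>\<open>X p\<close> depends on the germ at p, so agreement near m is first turned
    into agreement near each p close to m.\<close>
  have "\<forall>\<^sub>F p in nhds m. \<forall>\<^sub>F x in nhds p. f x = g x"
    using cong.hyps(2) by (simp add: eventually_eventually)
  then have "\<forall>\<^sub>F p in nhds m. X p f = X p g"
    using smooth_near_eventually[OF vanishes_to_near[OF cong.hyps(1)]]
    by eventually_elim (rule tangentD(4)[OF vfD(1)[OF X]])
  then show ?case by (rule vanishes_to.cong[OF cong.IH])
qed

lemma iterated_action_simps:
  "iterated_action [] f = f" "iterated_action (X # Xs) f = (\<lambda>p. X p (iterated_action Xs f))"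
  by (simp_all add: iterated_action_def)

lemma vanishes_to_iterated_action:
  "set Xs \<subseteq> vector_fields A \<Longrightarrow> vanishes_to A m n f \<Longrightarrow>
    vanishes_to A m (n - length Xs) (iterated_action Xs f)"
proof (induction Xs)
  case (Cons X Xs)
  then show ?case
    using vanishes_to_derivation[of X m "n - length Xs" "iterated_action Xs f"]
    by (simp add: iterated_action_simps)
qed (simp add: iterated_action_simps)

lemma iterated_action_smooth:
  "set Xs \<subseteq> vector_fields A \<Longrightarrow> f \<in> smooth_functions A \<Longrightarrow> iterated_action Xs f \<in> smooth_functions A"
  by (induction Xs) (auto simp: iterated_action_simps intro: vfD(3))

lemma vanishing_power_vanishes_to:
  assumes "f \<in> vanishing_power A n m"
  shows "vanishes_to A m n f"
proof -
  obtain N :: nat and g where g: "\<And>i j. i < N \<Longrightarrow> j < n \<Longrightarrow> g i j \<in> vanishing_at A m"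
    and f: "\<forall>\<^sub>F x in nhds m. f x = (\<Sum>i<N. \<Prod>j<n. g i j x)"
    using assms unfolding vanishing_power_def by blast
  have "vanishes_to A m k (\<lambda>x. \<Prod>j<k. g i j x)" if "i < N" "k \<le> n" for i k
    using that(2)
  proof (induction k)
    case 0
    then show ?case by (simp add: vanishes_to.smooth smooth_near_const)
  next
    case (Suc k)
    then show ?case using vanishes_to.mult[OF g[OF that(1), of k] Suc.IH] by (simp add: mult.commute)
  qed
  then have "vanishes_to A m n (\<lambda>x. \<Sum>i<N. \<Prod>j<n. g i j x)"
    by (intro vanishes_to_sum) simp
  moreover have "\<forall>\<^sub>F x in nhds m. (\<Sum>i<N. \<Prod>j<n. g i j x) = f x"
    using f by eventually_elim simp
  ultimately show ?thesis by (rule vanishes_to.cong)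
qed

section \<open>Tensor fields\<close>

lemma ex_vector_fields:
  assumes "vs \<in> tangent_lists A n m"
  shows "\<exists>Xs. set Xs \<subseteq> vector_fields A \<and> length Xs = n \<and> eval_fields Xs m = vs"
proof -
  have "set vs \<subseteq> tangent_space A m" using assms by (simp add: tangent_lists_def)
  then have "\<exists>Xs. set Xs \<subseteq> vector_fields A \<and> eval_fields Xs m = vs"
  proof (induction vs)
    case (Cons v vs)
    then obtain Xs where Xs: "set Xs \<subseteq> vector_fields A" "eval_fields Xs m = vs" by auto
    obtain X where "X \<in> vector_fields A" "X m = v" using ex_vector_field[of v m] Cons.prems by auto
    with Xs show ?case by (intro exI[of _ "X # Xs"]) auto
  qed simp
  then show ?thesis using assms by (auto simp: tangent_lists_def)
qed

lemma eval_fields_in: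
  "set Xs \<subseteq> vector_fields A \<Longrightarrow> eval_fields Xs m \<in> tangent_lists A (length Xs) m"
  using vfD(1) by (auto simp: tangent_lists_def)

lemma tensor_fieldD:
  assumes "\<omega> \<in> tensor_fields A n"
  shows "vs \<in> tangent_lists A n m \<Longrightarrow> i < n \<Longrightarrow> v \<in> tangent_space A m \<Longrightarrow> w \<in> tangent_space A m \<Longrightarrow>
      \<omega> m (vs[i := (\<lambda>f. a * v f + b * w f)]) = a * \<omega> m (vs[i := v]) + b * \<omega> m (vs[i := w])"
    "vs \<notin> tangent_lists A n m \<Longrightarrow> \<omega> m vs = 0"
    "length Xs = n \<Longrightarrow> set Xs \<subseteq> vector_fields A \<Longrightarrow> (\<lambda>m. \<omega> m (eval_fields Xs m)) \<in> smooth_functions A"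
  using assms unfolding tensor_fields_def tensors_at_def by blast+

lemma tensor_field_add:
  assumes "\<omega> \<in> tensor_fields A (length Xs)" "set Xs \<subseteq> vector_fields A" "i < length Xs"
    "Y \<in> vector_fields A" "Z \<in> vector_fields A"
  shows "\<omega> m (eval_fields (Xs[i := vf_add Y Z]) m) =
    \<omega> m (eval_fields (Xs[i := Y]) m) + \<omega> m (eval_fields (Xs[i := Z]) m)"
  using tensor_fieldD(1)[OF assms(1) eval_fields_in[OF assms(2)] assms(3) vfD(1)[OF assms(4)] vfD(1)[OF assms(5)], of m 1 1]
  by (simp add: map_update vf_add_def)

lemma tensor_field_scale:
  assumes "\<omega> \<in> tensor_fields A (length Xs)" "set Xs \<subseteq> vector_fields A" "i < length Xs"
    "Y \<in> vector_fields A"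
  shows "\<omega> m (eval_fields (Xs[i := vf_scale h Y]) m) = h m * \<omega> m (eval_fields (Xs[i := Y]) m)"
  using tensor_fieldD(1)[OF assms(1) eval_fields_in[OF assms(2)] assms(3) vfD(1)[OF assms(4)] vfD(1)[OF assms(4)], of m "h m" 0]
  by (simp add: map_update vf_scale_def)

lemma set_update_subset: "set Xs \<subseteq> S \<Longrightarrow> Y \<in> S \<Longrightarrow> set (Xs[i := Y]) \<subseteq> S"
  using set_update_subset_insert by fast

text \<open>
  The slots are replaced one after the other; in each step the form is tensorial in one slot.
\<close>

lemma multi_tensorial:
  fixes T :: "'a vfield list \<Rightarrow> real"
  assumes add: "\<And>Xs i Y Z. length Xs = n \<Longrightarrow> set Xs \<subseteq> vector_fields A \<Longrightarrow> i < n \<Longrightarrow>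
      Y \<in> vector_fields A \<Longrightarrow> Z \<in> vector_fields A \<Longrightarrow>
      T (Xs[i := vf_add Y Z]) = T (Xs[i := Y]) + T (Xs[i := Z])"
    and scale: "\<And>Xs i h Y. length Xs = n \<Longrightarrow> set Xs \<subseteq> vector_fields A \<Longrightarrow> i < n \<Longrightarrow>
      h \<in> smooth_functions A \<Longrightarrow> Y \<in> vector_fields A \<Longrightarrow>
      T (Xs[i := vf_scale h Y]) = h m * T (Xs[i := Y])"
    and Xs: "length Xs = n" "set Xs \<subseteq> vector_fields A"
    and Ys: "set Ys \<subseteq> vector_fields A"
    and eq: "eval_fields Xs m = eval_fields Ys m"
  shows "T Xs = T Ys"
proof -
  have len: "length Ys = n" using eq Xs(1) map_eq_imp_length_eq by metis
  have "T (take k Ys @ drop k Xs) = T Xs" if "k \<le> n" for k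
    using that
  proof (induction k)
    case (Suc k)
    let ?L = "take k Ys @ drop k Xs"
    have k: "k < n" using Suc.prems by simp
    have L: "length ?L = n" "set ?L \<subseteq> vector_fields A"
      using Xs Ys len k set_take_subset[of k Ys] set_drop_subset[of k Xs] by auto
    \<comment> \<open>Seen as an update of itself in slot k, the hybrid list is a value of the
      one-slot map to which \<open>tensorial\<close> applies.\<close>
    have "?L[k := Xs ! k] = ?L" using k Xs(1) len by (intro list_update_same_conv[THEN iffD2]) (auto simp: nth_append)
    moreover have "?L[k := Ys ! k] = take (Suc k) Ys @ drop (Suc k) Xs"
      using k Xs(1) len
      by (simp add: list_update_append take_Suc_conv_app_nth Cons_nth_drop_Suc[symmetric])
    moreover have "T (?L[k := Xs ! k]) = T (?L[k := Ys ! k])"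
    proof (rule tensorial[of "\<lambda>X. T (?L[k := X])" m "Xs ! k" "Ys ! k"])
      show "Xs ! k \<in> vector_fields A" "Ys ! k \<in> vector_fields A" using Xs Ys k len by auto
      show "(Xs ! k) m = (Ys ! k) m"
        using eq k Xs(1) len by (metis nth_map)
    qed (use add[OF L k] scale[OF L k] in auto)
    ultimately show ?case using Suc by simp
  qed simp
  from this[of n] show ?thesis using Xs(1) len by simp
qed

lemma tensor_field_smooth_near:
  assumes "\<omega> \<in> tensor_fields A (length Xs)" "set Xs \<subseteq> vector_fields A"
  shows "smooth_near A m (\<lambda>p. \<omega> p (eval_fields Xs p))"
  using smooth_functions_near tensor_fieldD(3)[OF assms(1) refl assms(2)] by blast

lemma differential_tensor_field:
  assumes "f \<in> smooth_functions A"
  shows "differential A f \<in> tensor_fields A 1"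
  unfolding tensor_fields_def tensors_at_def
proof (intro CollectI conjI allI ballI impI)
  fix m vs i v w a b
  assume *: "vs \<in> tangent_lists A 1 m" "i < (1::nat)" "v \<in> tangent_space A m" "w \<in> tangent_space A m"
  then obtain u where "vs = [u]" by (auto simp: tangent_lists_def length_Suc_conv)
  then show "differential A f m (vs[i := \<lambda>f. a * v f + b * w f]) =
      a * differential A f m (vs[i := v]) + b * differential A f m (vs[i := w])"
    using * tangent_lincomb[OF *(3,4)] by (simp add: differential_def tangent_lists_def)
next
  fix Xs assume Xs: "length Xs = 1 \<and> set Xs \<subseteq> vector_fields A"
  then obtain X where X: "Xs = [X]" "X \<in> vector_fields A" by (auto simp: length_Suc_conv)
  then have "(\<lambda>m. differential A f m (eval_fields Xs m)) = (\<lambda>m. X m f)"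
    using vfD(1) by (auto simp: differential_def tangent_lists_def)
  then show "(\<lambda>m. differential A f m (eval_fields Xs m)) \<in> smooth_functions A"
    using vfD(3)[OF X(2) assms] by simp
qed (simp add: differential_def)

end

section \<open>The covariant derivative of a tensor field\<close>

locale connection_mfd = smooth_mfd A for A :: "('a::t2_space, 'e::real_inner) chart set" +
  fixes D :: "'a vfield \<Rightarrow> 'a vfield \<Rightarrow> 'a vfield"
  assumes connection: "koszul_connection A D"
begin

lemma connectionD:
  assumes "X \<in> vector_fields A" "Y \<in> vector_fields A"
  shows "D X Y \<in> vector_fields A"
    "Z \<in> vector_fields A \<Longrightarrow> D (vf_add X Z) Y = vf_add (D X Y) (D Z Y)"
    "Z \<in> vector_fields A \<Longrightarrow> D X (vf_add Y Z) = vf_add (D X Y) (D X Z)"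
    "h \<in> smooth_functions A \<Longrightarrow> D (vf_scale h X) Y = vf_scale h (D X Y)"
    "h \<in> smooth_functions A \<Longrightarrow> D X (vf_scale h Y) = vf_add (vf_scale (\<lambda>m. X m h) Y) (vf_scale h (D X Y))"
  using connection assms unfolding koszul_connection_def by blast+

text \<open>The formula for the covariant derivative on fields. The differentiating field sits at
  the head of the list, so that it is one slot among the others and \<open>multi_tensorial\<close>
  treats all slots alike.\<close>

definition cov_form :: "('a \<Rightarrow> 'a ctensor) \<Rightarrow> 'a \<Rightarrow> 'a vfield list \<Rightarrow> real" where
  "cov_form \<omega> m Ys = hd Ys m (\<lambda>p. \<omega> p (eval_fields (tl Ys) p))
     - (\<Sum>i<length (tl Ys). \<omega> m (eval_fields ((tl Ys)[i := D (hd Ys) (tl Ys ! i)]) m))"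

lemma cov_form_Cons:
  "cov_form \<omega> m (X # Xs) = X m (\<lambda>p. \<omega> p (eval_fields Xs p))
     - (\<Sum>i<length Xs. \<omega> m (eval_fields (Xs[i := D X (Xs ! i)]) m))"
  by (simp add: cov_form_def)

text \<open>The head slot uses additivity of the connection in its direction. For another slot, the
  correction term in that very slot uses additivity in the differentiated field, while in the
  remaining terms the two updates concern different slots and commute.\<close>

lemma cov_form_add:
  assumes \<omega>: "\<omega> \<in> tensor_fields A n" and Ys: "length Ys = Suc n" "set Ys \<subseteq> vector_fields A"
    and i: "i < Suc n" and Y: "Y \<in> vector_fields A" and Z: "Z \<in> vector_fields A"
  shows "cov_form \<omega> m (Ys[i := vf_add Y Z]) = cov_form \<omega> m (Ys[i := Y]) + cov_form \<omega> m (Ys[i := Z])"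
proof -
  obtain X Xs where YX: "Ys = X # Xs" using Ys(1) by (cases Ys) auto
  with Ys have X: "X \<in> vector_fields A" and Xs: "length Xs = n" "set Xs \<subseteq> vector_fields A" by auto
  have nth: "Xs ! k \<in> vector_fields A" if "k < n" for k using that Xs by auto
  have D: "D X (Xs ! k) \<in> vector_fields A" if "k < n" "X \<in> vector_fields A" for k X
    using connectionD(1)[OF that(2) nth[OF that(1)]] .
  have \<omega>': "\<omega> \<in> tensor_fields A (length Xs)" using \<omega> Xs by simp
  show ?thesis
  proof (cases i)
    case 0
    have "\<omega> m (eval_fields (Xs[k := D (vf_add Y Z) (Xs ! k)]) m) =
        \<omega> m (eval_fields (Xs[k := D Y (Xs ! k)]) m) + \<omega> m (eval_fields (Xs[k := D Z (Xs ! k)]) m)"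
      if "k < n" for k
      using tensor_field_add[OF \<omega>' Xs(2) _ D[OF that Y] D[OF that Z], of k] that Xs(1)
        connectionD(2)[OF Y nth[OF that] Z] by simp
    then show ?thesis using 0 Xs(1) by (simp add: YX cov_form_Cons vf_add_def[of Y Z, THEN fun_cong, THEN fun_cong] sum.distrib)
  next
    case (Suc j)
    then have j: "j < n" using i by simp
    have S: "\<omega> p (eval_fields (L[j := vf_add Y' Z']) p) = \<omega> p (eval_fields (L[j := Y']) p) + \<omega> p (eval_fields (L[j := Z']) p)"
      if "length L = n" "set L \<subseteq> vector_fields A" "Y' \<in> vector_fields A" "Z' \<in> vector_fields A" for L p Y' Z'
      using tensor_field_add[of \<omega> L j Y' Z' p] that \<omega> j by simp
    have near: "smooth_near A m (\<lambda>p. \<omega> p (eval_fields (Xs[j := W]) p))" if "W \<in> vector_fields A" for W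
      using tensor_field_smooth_near[of \<omega> "Xs[j := W]" m] \<omega>' set_update_subset[OF Xs(2) that] by simp
    have 1: "X m (\<lambda>p. \<omega> p (eval_fields (Xs[j := vf_add Y Z]) p)) =
        X m (\<lambda>p. \<omega> p (eval_fields (Xs[j := Y]) p)) + X m (\<lambda>p. \<omega> p (eval_fields (Xs[j := Z]) p))"
      unfolding S[OF Xs Y Z] by (rule tangentD(1)[OF vfD(1)[OF X] near[OF Y] near[OF Z]])
    let ?t = "\<lambda>W k. \<omega> m (eval_fields (Xs[j := W, k := D X (Xs[j := W] ! k)]) m)"
    have 2: "?t (vf_add Y Z) k = ?t Y k + ?t Z k" if k: "k < n" for k
    proof (cases "k = j")
      case True
      then show ?thesis using S[OF Xs connectionD(1)[OF X Y] connectionD(1)[OF X Z]] connectionD(3)[OF X Y Z] j Xs(1)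
        by simp
    next
      case False
      have "Xs[j := W, k := D X (Xs[j := W] ! k)] = Xs[k := D X (Xs ! k), j := W]" for W
        using False by (simp add: list_update_swap)
      then show ?thesis
        using S[OF _ set_update_subset[OF Xs(2) D[OF k X]] Y Z] Xs(1) by simp
    qed
    show ?thesis using Suc Xs(1) 1 2 by (simp add: YX cov_form_Cons sum.distrib)
  qed
qed

text \<open>In a slot behind the head, two Leibniz rules compete: differentiating the function value
  produces an extra multiple of \<open>X m h\<close>, and the connection produces the same multiple
  in the correction term of that slot. The minus sign makes them cancel.\<close>

lemma cov_form_scale:
  assumes \<omega>: "\<omega> \<in> tensor_fields A n" and Ys: "length Ys = Suc n" "set Ys \<subseteq> vector_fields A"
    and i: "i < Suc n" and h: "h \<in> smooth_functions A" and Y: "Y \<in> vector_fields A"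
  shows "cov_form \<omega> m (Ys[i := vf_scale h Y]) = h m * cov_form \<omega> m (Ys[i := Y])"
proof -
  obtain X Xs where YX: "Ys = X # Xs" using Ys(1) by (cases Ys) auto
  with Ys have X: "X \<in> vector_fields A" and Xs: "length Xs = n" "set Xs \<subseteq> vector_fields A" by auto
  have nth: "Xs ! k \<in> vector_fields A" if "k < n" for k using that Xs by auto
  have D: "D X (Xs ! k) \<in> vector_fields A" if "k < n" "X \<in> vector_fields A" for k X
    using connectionD(1)[OF that(2) nth[OF that(1)]] .
  have \<omega>': "\<omega> \<in> tensor_fields A (length Xs)" using \<omega> Xs by simp
  show ?thesis
  proof (cases i)
    case 0
    have "\<omega> m (eval_fields (Xs[k := D (vf_scale h Y) (Xs ! k)]) m) =
        h m * \<omega> m (eval_fields (Xs[k := D Y (Xs ! k)]) m)"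
      if "k < n" for k
      using tensor_field_scale[OF \<omega>' Xs(2) _ D[OF that Y], of k] that Xs(1)
        connectionD(4)[OF Y nth[OF that] h] by simp
    then show ?thesis using 0 Xs(1)
      by (simp add: YX cov_form_Cons vf_scale_def[of h Y, THEN fun_cong, THEN fun_cong] sum_distrib_left right_diff_distrib)
  next
    case (Suc j)
    then have j: "j < n" using i by simp
    have S: "\<omega> p (eval_fields (L[j := vf_scale k Y']) p) = k p * \<omega> p (eval_fields (L[j := Y']) p)"
      if "length L = n" "set L \<subseteq> vector_fields A" "Y' \<in> vector_fields A" for L p Y' k
      using tensor_field_scale[of \<omega> L j Y' p k] that \<omega> j by simp
    have near: "smooth_near A m (\<lambda>p. \<omega> p (eval_fields (Xs[j := Y]) p))"
      using tensor_field_smooth_near[of \<omega> "Xs[j := Y]" m] \<omega>' set_update_subset[OF Xs(2) Y] by simp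
    let ?g = "\<lambda>p. \<omega> p (eval_fields (Xs[j := Y]) p)"
    have 1: "X m (\<lambda>p. \<omega> p (eval_fields (Xs[j := vf_scale h Y]) p)) = h m * X m ?g + ?g m * X m h"
      unfolding S[OF Xs Y] by (rule tangentD(2)[OF vfD(1)[OF X] smooth_functions_near[OF h] near])
    let ?t = "\<lambda>W k. \<omega> m (eval_fields (Xs[j := W, k := D X (Xs[j := W] ! k)]) m)"
    \<comment> \<open>The extra contribution occurs for exactly one index, hence exactly once in the
      sum below.\<close>
    have 2: "?t (vf_scale h Y) k = h m * ?t Y k + (if k = j then X m h * ?g m else 0)" if k: "k < n" for k
    proof (cases "k = j")
      case True
      have "?t (vf_scale h Y) k = \<omega> m (eval_fields (Xs[j := vf_add (vf_scale (\<lambda>m. X m h) Y) (vf_scale h (D X Y))]) m)"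
        using True connectionD(5)[OF X Y h] j Xs(1) by simp
      also have "\<dots> = X m h * ?g m + h m * \<omega> m (eval_fields (Xs[j := D X Y]) m)"
        using tensor_field_add[OF \<omega>' Xs(2) _ vf_scale_closed[OF vfD(3)[OF X h] Y] vf_scale_closed[OF h connectionD(1)[OF X Y]], of j]
          S[OF Xs Y] S[OF Xs connectionD(1)[OF X Y]] j Xs(1) by simp
      finally show ?thesis using True j Xs(1) by simp
    next
      case False
      have "Xs[j := W, k := D X (Xs[j := W] ! k)] = Xs[k := D X (Xs ! k), j := W]" for W
        using False by (simp add: list_update_swap)
      then show ?thesis
        using S[OF _ set_update_subset[OF Xs(2) D[OF k X]] Y] Xs(1) False by simp
    qed
    have "(\<Sum>k<n. ?t (vf_scale h Y) k) = h m * (\<Sum>k<n. ?t Y k) + X m h * ?g m"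
      using 2 j by (simp add: sum.distrib sum_distrib_left)
    then show ?thesis using Suc Xs(1) 1 by (simp add: YX cov_form_Cons right_diff_distrib)
  qed
qed

text \<open>Tensoriality in every slot makes the described value unique, so the definite description
  becomes a computation rule valid for any choice of fields.\<close>

lemma covariant_deriv_eq:
  assumes \<omega>: "\<omega> \<in> tensor_fields A n" and Ys: "length Ys = Suc n" "set Ys \<subseteq> vector_fields A"
  shows "covariant_deriv A D n \<omega> m (eval_fields Ys m) = cov_form \<omega> m Ys"
proof -
  obtain X Xs where YX: "Ys = X # Xs" using Ys(1) by (cases Ys) auto
  have "(THE r. \<exists>X Xs. X \<in> vector_fields A \<and> set Xs \<subseteq> vector_fields A \<and>
      eval_fields (X # Xs) m = eval_fields Ys m \<and>
      r = X m (\<lambda>p. \<omega> p (eval_fields Xs p)) - (\<Sum>i<n. \<omega> m (eval_fields (Xs[i := D X (Xs ! i)]) m))) =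
    cov_form \<omega> m Ys"
  proof (rule the_equality)
    show "\<exists>X Xs. X \<in> vector_fields A \<and> set Xs \<subseteq> vector_fields A \<and>
      eval_fields (X # Xs) m = eval_fields Ys m \<and>
      cov_form \<omega> m Ys = X m (\<lambda>p. \<omega> p (eval_fields Xs p)) - (\<Sum>i<n. \<omega> m (eval_fields (Xs[i := D X (Xs ! i)]) m))"
      using Ys by (intro exI[of _ X] exI[of _ Xs]) (simp add: YX cov_form_Cons)
    fix r assume "\<exists>X Xs. X \<in> vector_fields A \<and> set Xs \<subseteq> vector_fields A \<and>
      eval_fields (X # Xs) m = eval_fields Ys m \<and>
      r = X m (\<lambda>p. \<omega> p (eval_fields Xs p)) - (\<Sum>i<n. \<omega> m (eval_fields (Xs[i := D X (Xs ! i)]) m))"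
    then obtain X' Xs' where X': "set (X' # Xs') \<subseteq> vector_fields A" "eval_fields (X' # Xs') m = eval_fields Ys m"
      and r: "r = X' m (\<lambda>p. \<omega> p (eval_fields Xs' p)) - (\<Sum>i<n. \<omega> m (eval_fields (Xs'[i := D X' (Xs' ! i)]) m))"
      by auto
    have len: "length (X' # Xs') = Suc n" using X'(2) Ys(1) map_eq_imp_length_eq by metis
    have "cov_form \<omega> m (X' # Xs') = cov_form \<omega> m Ys"
      by (rule multi_tensorial[OF cov_form_add[OF \<omega>] cov_form_scale[OF \<omega>] len X'(1) Ys(2) X'(2)])
    then show "r = cov_form \<omega> m Ys" using r len by (simp add: cov_form_Cons)
  qed
  then show ?thesis
    using eval_fields_in[OF Ys(2), of m] Ys(1) by (simp add: covariant_deriv_def)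
qed

text \<open>After extending the vectors to fields, pointwise linearity is the case of constant
  coefficient functions; smoothness is read off the formula on fields.\<close>

lemma covariant_deriv_tensor_field:
  assumes \<omega>: "\<omega> \<in> tensor_fields A n"
  shows "covariant_deriv A D n \<omega> \<in> tensor_fields A (Suc n)"
  unfolding tensor_fields_def tensors_at_def
proof (intro CollectI conjI allI ballI impI)
  fix m vs i v w a b
  assume *: "vs \<in> tangent_lists A (Suc n) m" "i < Suc n" "v \<in> tangent_space A m" "w \<in> tangent_space A m"
  obtain Ys where Ys: "set Ys \<subseteq> vector_fields A" "eval_fields Ys m = vs" and len: "length Ys = Suc n"
    using ex_vector_fields[OF *(1)] by blast
  obtain V where V: "V \<in> vector_fields A" "V m = v" using ex_vector_field[OF *(3)] .
  obtain W where W: "W \<in> vector_fields A" "W m = w" using ex_vector_field[OF *(4)] .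
  let ?V = "vf_scale (\<lambda>_. a) V" and ?W = "vf_scale (\<lambda>_. b) W"
  have VW: "?V \<in> vector_fields A" "?W \<in> vector_fields A" "vf_add ?V ?W \<in> vector_fields A"
    using V(1) W(1) by (auto intro: vf_scale_closed vf_add_closed smooth_functions_const)
  have eq: "covariant_deriv A D n \<omega> m (vs[i := U m]) = cov_form \<omega> m (Ys[i := U])" if "U \<in> vector_fields A" for U
    using covariant_deriv_eq[OF \<omega> _ set_update_subset[OF Ys(1) that, of i], of m] len Ys(2)
    by (simp add: map_update)
  have "(\<lambda>f. a * v f + b * w f) = vf_add ?V ?W m"
    using V(2) W(2) by (simp add: vf_add_def vf_scale_def)
  then have "covariant_deriv A D n \<omega> m (vs[i := \<lambda>f. a * v f + b * w f]) = cov_form \<omega> m (Ys[i := vf_add ?V ?W])"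
    using eq[OF VW(3)] by simp
  also have "\<dots> = a * cov_form \<omega> m (Ys[i := V]) + b * cov_form \<omega> m (Ys[i := W])"
    using cov_form_add[OF \<omega> len Ys(1) *(2) VW(1,2)] cov_form_scale[OF \<omega> len Ys(1) *(2) smooth_functions_const V(1)]
      cov_form_scale[OF \<omega> len Ys(1) *(2) smooth_functions_const W(1)] by simp
  finally show "covariant_deriv A D n \<omega> m (vs[i := \<lambda>f. a * v f + b * w f]) =
      a * covariant_deriv A D n \<omega> m (vs[i := v]) + b * covariant_deriv A D n \<omega> m (vs[i := w])"
    using eq[OF V(1)] eq[OF W(1)] V(2) W(2) by simp
next
  fix Ys assume Ys: "length Ys = Suc n \<and> set Ys \<subseteq> vector_fields A"
  then obtain X Xs where YX: "Ys = X # Xs" by (cases Ys) auto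
  with Ys have X: "X \<in> vector_fields A" and Xs: "length Xs = n" "set Xs \<subseteq> vector_fields A" by auto
  have "(\<lambda>m. covariant_deriv A D n \<omega> m (eval_fields Ys m)) =
      (\<lambda>m. X m (\<lambda>p. \<omega> p (eval_fields Xs p)) - (\<Sum>i<n. \<omega> m (eval_fields (Xs[i := D X (Xs ! i)]) m)))"
    using covariant_deriv_eq[OF \<omega>, of Ys] Ys Xs(1) by (auto simp: YX cov_form_Cons)
  moreover have "smooth_fun_on A UNIV \<dots>"
  proof (intro smooth_fun_on_diff smooth_fun_on_sum open_UNIV)
    show "smooth_fun_on A UNIV (\<lambda>m. X m (\<lambda>p. \<omega> p (eval_fields Xs p)))"
      using vfD(3)[OF X tensor_fieldD(3)[OF \<omega> Xs]] by (simp add: smooth_functions_iff)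
    show "smooth_fun_on A UNIV (\<lambda>m. \<omega> m (eval_fields (Xs[i := D X (Xs ! i)]) m))" if "i \<in> {..<n}" for i
    proof -
      have "Xs ! i \<in> vector_fields A" using that Xs by auto
      from tensor_fieldD(3)[OF \<omega> _ set_update_subset[OF Xs(2) connectionD(1)[OF X this]], of i]
      show ?thesis using Xs(1) by (simp add: smooth_functions_iff)
    qed
  qed
  ultimately show "(\<lambda>m. covariant_deriv A D n \<omega> m (eval_fields Ys m)) \<in> smooth_functions A"
    by (simp add: smooth_functions_iff)
qed (simp add: covariant_deriv_def)

section \<open>Iterated covariant derivatives of a function\<close>

lemma iterated_covariant_deriv_tensor_field:
  assumes "f \<in> smooth_functions A"
  shows "iterated_covariant_deriv A D (Suc n) f \<in> tensor_fields A (Suc n)"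
  by (induction n) (use differential_tensor_field[OF assms] covariant_deriv_tensor_field in auto)

lemma smooth_functions_lincomb:
  "f \<in> smooth_functions A \<Longrightarrow> g \<in> smooth_functions A \<Longrightarrow> (\<lambda>x. a * f x + b * g x) \<in> smooth_functions A"
  unfolding smooth_functions_iff by (intro smooth_fun_on_add smooth_fun_on_cmult)

text \<open>A tangent vector is linear only on smooth germs; the tensor field property at the
  preceding order guarantees that the functions being differentiated are smooth.\<close>

lemma iterated_covariant_deriv_linear:
  assumes f: "f \<in> smooth_functions A" and g: "g \<in> smooth_functions A"
  shows "iterated_covariant_deriv A D (Suc n) (\<lambda>x. a * f x + b * g x) =
    (\<lambda>m vs. a * iterated_covariant_deriv A D (Suc n) f m vs + b * iterated_covariant_deriv A D (Suc n) g m vs)"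
proof (induction n)
  case 0
  show ?case
  proof (intro ext)
    fix m vs
    show "iterated_covariant_deriv A D (Suc 0) (\<lambda>x. a * f x + b * g x) m vs =
        a * iterated_covariant_deriv A D (Suc 0) f m vs + b * iterated_covariant_deriv A D (Suc 0) g m vs"
    proof (cases "vs \<in> tangent_lists A 1 m")
      case True
      then obtain v where v: "vs = [v]" "v \<in> tangent_space A m"
        by (auto simp: tangent_lists_def length_Suc_conv)
      have "v (\<lambda>x. a * f x + b * g x) = a * v f + b * v g"
        using tangentD(1)[OF v(2) smooth_near_cmult smooth_near_cmult] tangentD(3)[OF v(2)]
          smooth_functions_near[OF f] smooth_functions_near[OF g] by simp
      then show ?thesis using True v by (simp add: differential_def)
    qed (simp add: differential_def)
  qed
next
  case (Suc n)
  let ?N = "iterated_covariant_deriv A D (Suc n)"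
  note tf = iterated_covariant_deriv_tensor_field[OF f, of n]
  note tg = iterated_covariant_deriv_tensor_field[OF g, of n]
  note tfg = iterated_covariant_deriv_tensor_field[OF smooth_functions_lincomb[OF f g], of n a b]
  show ?case
  proof (intro ext)
    fix m vs
    show "iterated_covariant_deriv A D (Suc (Suc n)) (\<lambda>x. a * f x + b * g x) m vs =
        a * iterated_covariant_deriv A D (Suc (Suc n)) f m vs + b * iterated_covariant_deriv A D (Suc (Suc n)) g m vs"
    proof (cases "vs \<in> tangent_lists A (Suc (Suc n)) m")
      case True
      then obtain Ys where Ys: "set Ys \<subseteq> vector_fields A" "eval_fields Ys m = vs" "length Ys = Suc (Suc n)"
        using ex_vector_fields by blast
      then obtain X Xs where YX: "Ys = X # Xs" by (cases Ys) auto
      with Ys have X: "X \<in> vector_fields A" and Xs: "length Xs = Suc n" "set Xs \<subseteq> vector_fields A" by auto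
      have nf: "smooth_near A m (\<lambda>p. ?N f p (eval_fields Xs p))" and ng: "smooth_near A m (\<lambda>p. ?N g p (eval_fields Xs p))"
        using tensor_field_smooth_near[of _ Xs m] tf tg Xs by auto
      have "X m (\<lambda>p. a * ?N f p (eval_fields Xs p) + b * ?N g p (eval_fields Xs p)) =
          a * X m (\<lambda>p. ?N f p (eval_fields Xs p)) + b * X m (\<lambda>p. ?N g p (eval_fields Xs p))"
        using tangentD(1)[OF vfD(1)[OF X] smooth_near_cmult[OF nf] smooth_near_cmult[OF ng]]
          tangentD(3)[OF vfD(1)[OF X] nf] tangentD(3)[OF vfD(1)[OF X] ng] by simp
      then have "cov_form (?N (\<lambda>x. a * f x + b * g x)) m Ys = a * cov_form (?N f) m Ys + b * cov_form (?N g) m Ys"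
        by (simp add: YX cov_form_Cons Suc.IH sum.distrib sum_distrib_left[symmetric] algebra_simps del: iterated_covariant_deriv.simps)
      then show ?thesis
        using covariant_deriv_eq[OF tf Ys(3,1), of m] covariant_deriv_eq[OF tg Ys(3,1), of m]
          covariant_deriv_eq[OF tfg Ys(3,1), of m] Ys(2) by simp
    qed (simp add: covariant_deriv_def)
  qed
qed

section \<open>Comparison with the iterated action\<close>

text \<open>
  In \<open>\<nabla>\<^sup>n f(X\<^sub>1, \<dots>, X\<^sub>n) - X\<^sub>1 \<cdots> X\<^sub>n f\<close> only derivatives of \<open>f\<close> of order less than \<open>n\<close> occur.
\<close>

lemma iterated_covariant_deriv_minus_iterated_action:
  assumes f: "f \<in> smooth_functions A"
  shows "vanishes_to A m (Suc n + j) f \<Longrightarrow> length Ys = Suc n \<Longrightarrow> set Ys \<subseteq> vector_fields A \<Longrightarrow>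
    vanishes_to A m (Suc j)
      (\<lambda>p. iterated_covariant_deriv A D (Suc n) f p (eval_fields Ys p) - iterated_action Ys f p)"
proof (induction n arbitrary: j Ys)
  case 0
  then obtain X where X: "Ys = [X]" "X \<in> vector_fields A" by (auto simp: length_Suc_conv)
  then have "(\<lambda>p. iterated_covariant_deriv A D (Suc 0) f p (eval_fields Ys p) - iterated_action Ys f p) = (\<lambda>p. 0)"
    using vfD(1) by (auto simp: differential_def tangent_lists_def iterated_action_simps)
  then show ?case by (simp only: vanishes_to.zero)
next
  case (Suc n)
  let ?N = "iterated_covariant_deriv A D (Suc n) f"
  note tf = iterated_covariant_deriv_tensor_field[OF f, of n]
  obtain X Xs where YX: "Ys = X # Xs" using Suc.prems(2) by (cases Ys) auto
  with Suc.prems have X: "X \<in> vector_fields A" and Xs: "length Xs = Suc n" "set Xs \<subseteq> vector_fields A" by auto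
  let ?Z = "\<lambda>i. Xs[i := D X (Xs ! i)]"
  have Z: "length (?Z i) = Suc n" "set (?Z i) \<subseteq> vector_fields A" if "i < Suc n" for i
  proof -
    have "Xs ! i \<in> vector_fields A" using Xs that by auto
    from set_update_subset[OF Xs(2) connectionD(1)[OF X this], of i] Xs(1)
    show "length (?Z i) = Suc n" "set (?Z i) \<subseteq> vector_fields A" by simp_all
  qed
  \<comment> \<open>One order is moved from the count of fields to the surplus. The induction
    hypothesis then gives differences of order j + 2, and the outer field X takes one away.\<close>
  have van: "vanishes_to A m (Suc n + Suc j) f" using Suc.prems(1) by simp
  let ?d = "\<lambda>Xs p. ?N p (eval_fields Xs p) - iterated_action Xs f p"
  have 1: "vanishes_to A m (Suc j) (\<lambda>p. X p (?d Xs))"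
    using vanishes_to_derivation[OF X Suc.IH[OF van Xs]] by simp
  \<comment> \<open>Each correction term is split into a difference covered by the induction
    hypothesis and an iterated action. The latter applies only n + 1 fields to a function of order n
    + 2 + j, so order j + 1 remains.\<close>
  have 2: "vanishes_to A m (Suc j) (\<lambda>p. ?d (?Z i) p + iterated_action (?Z i) f p)" if "i < Suc n" for i
  proof (rule vanishes_to.add)
    show "vanishes_to A m (Suc j) (?d (?Z i))"
      using vanishes_to_pred[OF Suc.IH[OF van Z[OF that]]] by simp
    show "vanishes_to A m (Suc j) (iterated_action (?Z i) f)"
      using vanishes_to_iterated_action[OF Z(2)[OF that] van] Xs(1) by simp
  qed
  have "vanishes_to A m (Suc j) (\<lambda>p. X p (?d Xs) - (\<Sum>i<Suc n. ?d (?Z i) p + iterated_action (?Z i) f p))"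
    by (intro vanishes_to_diff vanishes_to_sum 1) (rule 2, simp)
  moreover have "X p (?d Xs) - (\<Sum>i<Suc n. ?d (?Z i) p + iterated_action (?Z i) f p) =
      iterated_covariant_deriv A D (Suc (Suc n)) f p (eval_fields Ys p) - iterated_action Ys f p" for p
  proof -
    have n1: "smooth_near A p (\<lambda>p. ?N p (eval_fields Xs p))" using tensor_field_smooth_near[of _ Xs p] tf Xs by auto
    have n2: "smooth_near A p (iterated_action Xs f)"
      using smooth_functions_near[OF iterated_action_smooth[OF Xs(2) f]] .
    have "X p (?d Xs) = X p (\<lambda>p. ?N p (eval_fields Xs p)) - X p (iterated_action Xs f)"
      using tangentD(1)[OF vfD(1)[OF X] n1 smooth_near_cmult[OF n2], of "-1"] tangentD(3)[OF vfD(1)[OF X] n2, of "-1"]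
      by simp
    moreover have "iterated_covariant_deriv A D (Suc (Suc n)) f p (eval_fields Ys p) =
        X p (\<lambda>p. ?N p (eval_fields Xs p)) - (\<Sum>i<Suc n. ?N p (eval_fields (?Z i) p))"
      using covariant_deriv_eq[OF tf Suc.prems(2,3), of p] Xs(1)
      by (simp add: YX cov_form_Cons del: sum.lessThan_Suc)
    ultimately show ?thesis by (simp add: YX iterated_action_simps del: sum.lessThan_Suc iterated_covariant_deriv.simps)
  qed
  ultimately show ?case by simp
qed

lemma higher_deriv_eq_iterated_covariant_deriv:
  assumes f: "f \<in> smooth_functions A" and van: "f \<in> vanishing_power A (Suc n) m"
  shows "iterated_covariant_deriv A D (Suc n) f m = higher_deriv A (Suc n) f m"
proof
  fix vs
  let ?N = "iterated_covariant_deriv A D (Suc n) f"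
  show "?N m vs = higher_deriv A (Suc n) f m vs"
  proof (cases "vs \<in> tangent_lists A (Suc n) m")
    case True
    have eq: "iterated_action Xs f m = ?N m vs"
      \<comment> \<open>Being stated for every extension of vs, this gives both the value of the
        definite description and its uniqueness.\<close>
      if "set Xs \<subseteq> vector_fields A" "eval_fields Xs m = vs" for Xs
    proof -
      have "length Xs = Suc n" using that(2) True by (auto simp: tangent_lists_def)
      \<comment> \<open>With surplus 0 the difference vanishes to order one, hence is zero at
        m.\<close>
      from iterated_covariant_deriv_minus_iterated_action[OF f _ this that(1), of m 0]
      show ?thesis
        using vanishing_power_vanishes_to[OF van] vanishes_to_eq_0 that(2) by fastforce
    qed
    obtain Xs where "set Xs \<subseteq> vector_fields A" "eval_fields Xs m = vs"
      using ex_vector_fields[OF True] by blast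
    then have "(THE r. \<exists>Xs. set Xs \<subseteq> vector_fields A \<and> eval_fields Xs m = vs \<and> r = iterated_action Xs f m) = ?N m vs"
      using eq by (intro the_equality) (metis, metis)
    then show ?thesis using True by (simp add: higher_deriv_def)
  next
    case False
    \<comment> \<open>On lists that are not tangent vectors at m, both sides take the default value
      0.\<close>
    then show ?thesis
      using tensor_fieldD(2)[OF iterated_covariant_deriv_tensor_field[OF f]] by (simp add: higher_deriv_def)
  qed
qed

end

theorem theorem2p2:
  fixes A :: "('a::t2_space, 'e::real_inner) chart set"
    and D :: "'a vfield \<Rightarrow> 'a vfield \<Rightarrow> 'a vfield"
    and n :: nat
  assumes "smooth_manifold A"
    and "koszul_connection A D"
    and "n \<ge> 1"
  shows "hessian_structure A n (\<lambda>f. iterated_covariant_deriv A D n f)"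
proof -
  interpret connection_mfd A D by unfold_locales (fact assms(1), fact assms(2))
  \<comment> \<open>The preceding facts are stated for \<open>Suc k\<close>, which avoids the dummy
    value of \<open>iterated_covariant_deriv\<close> at 0.\<close>
  obtain k where "n = Suc k" using assms(3) by (cases n) auto
  then show ?thesis
    unfolding hessian_structure_def
    using iterated_covariant_deriv_tensor_field iterated_covariant_deriv_linear
      higher_deriv_eq_iterated_covariant_deriv by simp
qed

end
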